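(* Let $\rho>0$ and consider the Mallows culture on candidates $\{1,2,3,4\}$ with reference ranking $(1,2,3,4)$ and concentration parameter $\rho$, with $n$ independent voters. Let $\boldsymbol\zeta=(e^{-2\rho},e^{-\rho},1)$, $\boldsymbol\tau=(-2\rho,-\rho,0)$, and $\mathcal{S}=\{1,2\}$. Let $M_{33}$ be the bottom-right entry of $\mathcal{H}_K(\boldsymbol\tau)^{-1}$. Then, as $n\to+\infty$, \[ \mathbb{P}(4\text{ is the Condorcet winner})\sim\frac{P(\boldsymbol\zeta)^n}{\prod_{j\in\mathcal{S}}\big((1-\zeta_j)\zeta_j^{\lceil n/2\rceil-1}\big)}\cdot\frac{1}{4\pi n\sqrt{\det(\mathcal{H}_K(\boldsymbol\tau))\,M_{33}}}. \]
   Context: Mallows culture with reference ranking $r_0$ and parameter $\rho$: each voter independently draws ranking $r$ with probability $\gamma e^{-\rho d(r,r_0)}$, $d$ the Kendall tau distance (number of discordant pairs), $\gamma$ normalizing. Candidate $4$ is the Condorcet winner if, for each $j\in\{1,2,3\}$, strictly more than $n/2$ voters rank $4$ above $j$. For $\mathcal{X}\subseteq\{1,2,3\}$, $p_{\mathcal{X}}$ is the probability that the set of candidates ranked above $4$ is exactly $\mathcal{X}$; $P(\mathbf{x})=\sum_{\mathcal{X}}p_{\mathcal{X}}\prod_{j\in\mathcal{X}}x_j$; $K(\mathbf{t})=\log P(e^{t_1},e^{t_2},e^{t_3})$ and $\mathcal{H}_K(\boldsymbol\tau)$ is its Hessian at $\boldsymbol\tau$. *)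

theory Defs
  imports Complex_Main "HOL-Library.Landau_Symbols"
    "HOL-Combinatorics.Multiset_Permutations"
    "Jordan_Normal_Form.Gauss_Jordan_Elimination" "Jordan_Normal_Form.Determinant"
begin

(* A ranking of the candidates {1,2,3,4} is a list of all four candidates,
   most preferred first. *)
definition rankings :: "nat list set" where
  "rankings = permutations_of_set {1,2,3,4}"

definition above :: "nat list \<Rightarrow> nat \<Rightarrow> nat \<Rightarrow> bool" where
  "above r a b \<longleftrightarrow> (\<exists>i k. i < k \<and> k < length r \<and> r ! i = a \<and> r ! k = b)"

definition kendall_ref :: "nat list \<Rightarrow> nat" where
  "kendall_ref r = card {(i,j). i \<in> {1,2,3,4} \<and> j \<in> {1,2,3,4} \<and> i < j \<and> above r j i}"

definition mallows :: "real \<Rightarrow> nat list \<Rightarrow> real" where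
  "mallows \<rho> r = (if r \<in> rankings then
      exp (- \<rho> * real (kendall_ref r)) / (\<Sum>r'\<in>rankings. exp (- \<rho> * real (kendall_ref r')))
    else 0)"

definition condorcet4 :: "nat \<Rightarrow> (nat \<Rightarrow> nat list) \<Rightarrow> bool" where
  "condorcet4 n prof \<longleftrightarrow>
     (\<forall>j\<in>{1,2,3}. real (card {v \<in> {..<n}. above (prof v) 4 j}) > real n / 2)"

definition prob_cw4 :: "real \<Rightarrow> nat \<Rightarrow> real" where
  "prob_cw4 \<rho> n = (\<Sum>prof \<in> PiE {..<n} (\<lambda>_. rankings).
      (if condorcet4 n prof then (\<Prod>v<n. mallows \<rho> (prof v)) else 0))"

definition pX :: "real \<Rightarrow> nat set \<Rightarrow> real" where
  "pX \<rho> X = (\<Sum>r\<in>{r \<in> rankings. {j \<in> {1,2,3}. above r j 4} = X}. mallows \<rho> r)"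

definition Pgen :: "real \<Rightarrow> (nat \<Rightarrow> real) \<Rightarrow> real" where
  "Pgen \<rho> x = (\<Sum>X\<in>Pow {1,2,3}. pX \<rho> X * (\<Prod>j\<in>X. x j))"

definition Kcgf :: "real \<Rightarrow> (nat \<Rightarrow> real) \<Rightarrow> real" where
  "Kcgf \<rho> t = ln (Pgen \<rho> (\<lambda>j. exp (t j)))"

(* partial derivative with respect to coordinate i (this is the unfolding of
   HOL-Analysis's deriv, which we do not import to avoid clashes with JNF) *)
definition partial :: "nat \<Rightarrow> ((nat \<Rightarrow> real) \<Rightarrow> real) \<Rightarrow> (nat \<Rightarrow> real) \<Rightarrow> real" where
  "partial i f t = (SOME D. ((\<lambda>s. f (t(i := s))) has_real_derivative D) (at (t i)))"

definition hessian3 :: "((nat \<Rightarrow> real) \<Rightarrow> real) \<Rightarrow> (nat \<Rightarrow> real) \<Rightarrow> real mat" where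
  "hessian3 f t = mat 3 3 (\<lambda>(i,j). partial (Suc i) (partial (Suc j) f) t)"

end

theory Submission
  imports "HOL-Analysis.Gamma_Function" "HOL-Real_Asymp.Real_Asymp" Defs
begin

text \<open>
  Tilting the ballots by \<open>\<zeta>\<close> makes the law of the set of candidates preferred to 4 invariant under
  complementation and permutation of \<open>{1,2,3}\<close>, so each \<open>j\<close> is preferred to 4 with probability
  \<open>1/2\<close>. With \<open>N\<^sub>j\<close> the number of voters preferring \<open>j\<close> to 4, \<open>m = \<lceil>n/2\<rceil> - 1\<close> and \<open>q = e\<^sup>-\<^sup>\<rho>\<close>,
  the winning probability becomes \<open>P(\<zeta>)\<^sup>n q\<^sup>-\<^sup>3\<^sup>m\<close> times the tilted expectation of
  \<open>q\<close> to the power \<open>2(m - N\<^sub>1) + (m - N\<^sub>2)\<close> on the event that all \<open>N\<^sub>j \<le> m\<close>.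

  Condition on the number \<open>D\<close> of voters who separate candidates 1 and 2. It is binomial, and given
  \<open>D\<close> the point probability of \<open>(N\<^sub>1, N\<^sub>2)\<close> is a product of two symmetric binomial point
  probabilities with \<open>D\<close> and \<open>n - D\<close> trials, each controlled by the Wallis product. The third
  coordinate is symmetric up to a bounded shift and hence contributes a factor \<open>1/2\<close>. Summing the
  geometric weights by Tannery's theorem gives the claim; \<open>det H \<cdot> M\<^sub>3\<^sub>3\<close> is the determinant of the
  covariance matrix of the first two coordinates.
\<close>

section \<open>Central binomial coefficients\<close>

text \<open>The obstacle is that D is random. Given D, the two point probabilities multiply to about
  2/pi divided by sqrt(D) sqrt(n - D), which is large near D = 0 and D = n, so concentration of D
  around its mean is not enough. The ends are controlled by inverse moments of D, which are explicit
  because binomial weights absorb a factor 1/(D+1). Moreover N_1 - N_2 has the parity of D, so only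
  every second D contributes. The limiting constant is thus 2/pi from the point probabilities, 1/2
  from parity, 1/2 from candidate 3, and 1/sqrt(p(1-p)) from the concentration of D, where p is the
  chance that a tilted ballot separates 1 and 2. Candidate 3 needs no local limit theorem: its
  tilting factor is 1, so only its distribution function near the median enters. Laws are coded as
  nested polynomials: coefficients in the two outer variables fix N_1 and N_2 and leave a univariate
  polynomial for N_3, while independence of voters becomes multiplication.\<close>

lemma central_binomial_Suc: "(2 * Suc k) choose Suc k = 2 * ((2*k+1) choose k)"
proof -
  have "Suc k * (Suc (Suc (2*k)) choose Suc k) = (2 * Suc k) * (Suc (2*k) choose k)"
    using Suc_times_binomial[of k "Suc (2*k)"] by (simp only: mult_Suc_right add_2_eq_Suc)
  also have "\<dots> = Suc k * (2 * (Suc (2*k) choose k))" by (simp only: ac_simps)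
  finally have "Suc k * (Suc (Suc (2*k)) choose Suc k) = Suc k * (2 * (Suc (2*k) choose k))" .
  hence "Suc (Suc (2*k)) choose Suc k = 2 * (Suc (2*k) choose k)"
    by (simp only: mult_cancel1) simp
  thus ?thesis by (simp only: mult_Suc_right Suc_eq_plus1[symmetric] add_2_eq_Suc)
qed

text \<open>The j-th Wallis factor is 4j^2 / ((2j-1)(2j+1)) and consecutive central probabilities
  have quotient (2k+1)/(2k+2), so everything telescopes. Being exact, the identity serves twice: all
  factors are at least 1, which bounds every k, and the limit pi/2 gives the asymptotics.\<close>

lemma central_binomial_wallis:
  "(real ((2*k) choose k) / 4^k)\<^sup>2 * (2*real k+1) * (\<Prod>j=1..k. (4*real j^2) / (4*real j^2 - 1)) = 1"
proof (induction k)
  case (Suc k)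
  have "Suc k * ((2*k+1) choose k) = (2*k+1) * ((2*k) choose k)"
    using Suc_times_binomial[of k "2*k"] binomial_symmetric[of k "Suc (2*k)"] by simp
  hence "real (Suc k * ((2*k+1) choose k)) = real ((2*k+1) * ((2*k) choose k))" by (simp only:)
  hence "real (Suc k) * real ((2 * Suc k) choose Suc k) = 2 * (2*real k+1) * real ((2*k) choose k)"
    unfolding central_binomial_Suc by (simp only: of_nat_mult of_nat_add) (simp add: algebra_simps)
  hence e: "real ((2 * Suc k) choose Suc k) / 4^Suc k
      = (2*real k+1) / (2*(real k+1)) * (real ((2*k) choose k) / 4^k)"
    by (simp add: divide_simps del: binomial_Suc_Suc) (simp add: algebra_simps del: binomial_Suc_Suc)
  have p: "4*(real (Suc k))\<^sup>2 - 1 = (2*real k+1)*(2*real k+3)"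
    by (simp add: power2_eq_square algebra_simps)
  have c: "((2*real k+1) / (2*(real k+1)))\<^sup>2 * (2*real (Suc k)+1) * ((4*(real (Suc k))\<^sup>2) / ((2*real k+1)*(2*real k+3)))
     = 2*real k+1"
  proof -
    have "(u / (2 * v))\<^sup>2 * w * ((4 * v\<^sup>2) / (u*w)) = u" if "u > 0" "v > 0" "w > 0" for u v w :: real
      using that by (simp add: power2_eq_square)
    from this[of "2*real k+1" "real k+1" "2*real k+3"] show ?thesis by (simp add: add.commute)
  qed
  have "(real ((2 * Suc k) choose Suc k) / 4^Suc k)\<^sup>2 * (2*real (Suc k)+1)
      * (\<Prod>j=1..Suc k. (4*real j^2) / (4*real j^2 - 1))
     = (((2*real k+1) / (2*(real k+1)))\<^sup>2 * (2*real (Suc k)+1) * ((4*(real (Suc k))\<^sup>2) / ((2*real k+1)*(2*real k+3))))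
      * ((real ((2*k) choose k) / 4^k)\<^sup>2 * (\<Prod>j=1..k. (4*real j^2) / (4*real j^2 - 1)))"
    unfolding e p[symmetric] by (simp only: prod.cl_ivl_Suc power_mult_distrib) simp
  also have "\<dots> = 1" unfolding c using Suc by (simp only: ac_simps)
  finally show ?case .
qed simp

lemma central_binomial_le: "real ((2*k) choose k) / 4^k \<le> 1 / sqrt (2*real k+1)"
proof -
  have "1 \<le> (\<Prod>j=1..k. (4*real j^2) / (4*real j^2 - 1))"
  proof (rule prod_ge_1)
    fix j assume "j \<in> {1..k}"
    hence "1 \<le> (real j)\<^sup>2" by simp
    thus "1 \<le> (4*real j^2) / (4*real j^2 - 1)" by (simp add: divide_simps)
  qed
  hence "(real ((2*k) choose k) / 4^k)\<^sup>2 * (2*real k+1) * 1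
      \<le> (real ((2*k) choose k) / 4^k)\<^sup>2 * (2*real k+1) * (\<Prod>j=1..k. (4*real j^2) / (4*real j^2 - 1))"
    by (intro mult_left_mono) auto
  also have "\<dots> = 1" by (rule central_binomial_wallis)
  finally have "(real ((2*k) choose k) / 4^k)\<^sup>2 * (2*real k+1) \<le> 1" by simp
  hence "(real ((2*k) choose k) / 4^k)\<^sup>2 \<le> (1 / sqrt (2*real k+1))\<^sup>2"
    by (simp add: field_simps)
  thus ?thesis by (rule power2_le_imp_le) simp
qed

lemma tendsto_central_binomial:
  "(\<lambda>k. sqrt (2*real k+1) * (real ((2*k) choose k) / 4^k)) \<longlonglongrightarrow> sqrt (2/pi)"
proof -
  have "(\<lambda>k. sqrt (inverse (\<Prod>j=1..k. (4*real j^2) / (4*real j^2 - 1)))) \<longlonglongrightarrow> sqrt (inverse (pi/2))"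
    using tendsto_real_sqrt[OF tendsto_inverse[OF wallis]] by simp
  moreover have "sqrt (inverse (\<Prod>j=1..k. (4*real j^2) / (4*real j^2 - 1)))
     = sqrt (2*real k+1) * (real ((2*k) choose k) / 4^k)" for k
  proof -
    have "inverse (\<Prod>j=1..k. (4*real j^2) / (4*real j^2 - 1)) = (real ((2*k) choose k) / 4^k)\<^sup>2 * (2*real k+1)"
      by (rule inverse_unique) (subst mult.commute, rule central_binomial_wallis)
    thus ?thesis by (simp add: real_sqrt_mult mult.commute)
  qed
  ultimately show ?thesis by simp
qed

lemma binomial_half_le: "real (n choose k) / 2^n \<le> 1 / sqrt (real n + 1)"
proof -
  have "real (n choose k) / 2^n \<le> real (n choose (n div 2)) / 2^n"
    by (intro divide_right_mono of_nat_mono binomial_maximum) auto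
  also have "\<dots> \<le> 1 / sqrt (real n + 1)"
  proof (cases "even n")
    case True
    then obtain k where "n = 2*k" by blast
    thus ?thesis using central_binomial_le[of k] by (simp add: power_mult)
  next
    case False
    then obtain k where n: "n = 2*k+1" using oddE by blast
    \<comment> \<open>The largest probability for an odd number of fair tosses equals the one for
      one toss more, so the odd case reduces to the even one.\<close>
    have "real (n choose (n div 2)) / 2^n = real ((2 * Suc k) choose Suc k) / 4^Suc k"
      unfolding central_binomial_Suc by (simp add: n power_mult)
    also have "\<dots> \<le> 1 / sqrt (2*real (Suc k)+1)" by (rule central_binomial_le)
    also have "\<dots> \<le> 1 / sqrt (real n + 1)" by (intro divide_left_mono) (auto simp: n)
    finally show ?thesis .
  qed
  finally show ?thesis .
qed

text \<open>A bounded displacement from the centre does not change the local limit: passing from row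
  2k+s to row 2k+s+1 at the same lower index k multiplies the scaled probability by an explicit
  quotient that tends to 1.\<close>

lemma tendsto_binomial_shift:
  "(\<lambda>k. sqrt (2*real k + real s + 1) * (real ((2*k+s) choose k) / 2^(2*k+s))) \<longlonglongrightarrow> sqrt (2/pi)"
proof (induction s)
  case 0
  show ?case using tendsto_central_binomial by (simp add: power_mult)
next
  case (Suc s)
  have "(\<lambda>k. sqrt ((2*real k + real s + 2)/(2*real k + real s + 1)) * ((2*real k + real s + 1) / (2*(real k + real s + 1)))
      * (sqrt (2*real k + real s + 1) * (real ((2*k+s) choose k) / 2^(2*k+s)))) \<longlonglongrightarrow> 1 * sqrt (2/pi)"
  proof (intro tendsto_mult Suc.IH)
    show "(\<lambda>k. sqrt ((2*real k + real s + 2)/(2*real k + real s + 1))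
        * ((2*real k + real s + 1) / (2*(real k + real s + 1)))) \<longlonglongrightarrow> 1"
      by real_asymp
  qed
  moreover have "sqrt ((2*real k + real s + 2)/(2*real k + real s + 1)) * ((2*real k + real s + 1) / (2*(real k + real s + 1)))
      * (sqrt (2*real k + real s + 1) * (real ((2*k+s) choose k) / 2^(2*k+s)))
     = sqrt (2*real k + real (Suc s) + 1) * (real ((2*k+Suc s) choose k) / 2^(2*k+Suc s))" for k
  proof -
    have "(k + s + 1) * ((2*k+Suc s) choose k) = (2*k+s+1) * ((2*k+s) choose k)"
      using Suc_times_binomial[of "k+s" "2*k+s"] binomial_symmetric[of "k+s" "2*k+s"]
       binomial_symmetric[of "k" "Suc (2*k+s)"]
      by (simp del: binomial_Suc_Suc)
    hence "real (k + s + 1) * real ((2*k+Suc s) choose k) = real (2*k+s+1) * real ((2*k+s) choose k)"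
      by (simp only: of_nat_mult[symmetric])
    hence e: "real ((2*k+Suc s) choose k) = (2*real k+real s+1) / (real k + real s + 1) * real ((2*k+s) choose k)"
      by (simp add: field_simps)
    have r: "sqrt ((2*real k + real s + 2)/(2*real k + real s + 1)) * sqrt (2*real k + real s + 1) = sqrt (2*real k + real s + 2)"
      by (simp add: real_sqrt_divide)
    have "sqrt ((2*real k + real s + 2)/(2*real k + real s + 1)) * ((2*real k + real s + 1) / (2*(real k + real s + 1)))
      * (sqrt (2*real k + real s + 1) * (real ((2*k+s) choose k) / 2^(2*k+s)))
      = (sqrt ((2*real k + real s + 2)/(2*real k + real s + 1)) * sqrt (2*real k + real s + 1)) * 
        (real ((2*k+Suc s) choose k) / 2^(2*k+Suc s))"
      unfolding e by (simp add: divide_simps)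
    thus ?thesis unfolding r by (simp add: ac_simps)
  qed
  ultimately show ?case by simp
qed

section \<open>Inverse moments of the binomial distribution\<close>

definition binom_mass :: "real \<Rightarrow> nat \<Rightarrow> nat \<Rightarrow> real" where
  "binom_mass p n D = real (n choose D) * p^D * (1-p)^(n-D)"

definition binom_expect :: "real \<Rightarrow> nat \<Rightarrow> (nat \<Rightarrow> real) \<Rightarrow> real" where
  "binom_expect p n f = (\<Sum>D\<le>n. binom_mass p n D * f D)"

lemma binom_mass_nonneg: "0 < p \<Longrightarrow> p < 1 \<Longrightarrow> 0 \<le> binom_mass p n D"
  by (simp add: binom_mass_def)

lemma binom_expect_mono:
  assumes "0 < p" "p < 1" "\<And>D. D \<le> n \<Longrightarrow> f D \<le> g D"
  shows "binom_expect p n f \<le> binom_expect p n g"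
  unfolding binom_expect_def using assms
  by (intro sum_mono mult_left_mono) (auto intro: binom_mass_nonneg)

lemma binom_expect_nonneg:
  assumes "0 < p" "p < 1" "\<And>D. D \<le> n \<Longrightarrow> 0 \<le> f D"
  shows "0 \<le> binom_expect p n f"
  unfolding binom_expect_def using assms
  by (intro sum_nonneg mult_nonneg_nonneg) (auto intro: binom_mass_nonneg)

lemma binom_expect_add: "binom_expect p n (\<lambda>D. f D + g D) = binom_expect p n f + binom_expect p n g"
  by (simp add: binom_expect_def algebra_simps sum.distrib)

lemma binom_expect_diff: "binom_expect p n (\<lambda>D. f D - g D) = binom_expect p n f - binom_expect p n g"
  by (simp add: binom_expect_def algebra_simps sum_subtractf)

lemma binom_expect_cmult: "binom_expect p n (\<lambda>D. c * f D) = c * binom_expect p n f"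
  by (simp add: binom_expect_def sum_distrib_left mult_ac)

lemma binom_expect_abs_le:
  assumes "0 < p" "p < 1"
  shows "\<bar>binom_expect p n f\<bar> \<le> binom_expect p n (\<lambda>D. \<bar>f D\<bar>)"
  unfolding binom_expect_def
  by (rule order_trans[OF sum_abs]) (auto intro!: sum_mono simp: abs_mult binom_mass_nonneg assms)

text \<open>Measures how evenly the mass is split between even and odd D: for 0 < p < 1 the
  imbalance decays exponentially.\<close>

lemma binom_expect_sign: "binom_expect p n (\<lambda>D. (-1)^D) = (1 - 2*p)^n"
proof -
  have "(1 - 2*p)^n = (- p + (1 - p))^n" by simp
  also have "\<dots> = (\<Sum>D\<le>n. of_nat (n choose D) * (-p)^D * (1-p)^(n-D))" by (rule binomial_ring)
  finally show ?thesis by (simp add: binom_expect_def binom_mass_def power_minus[of p] mult_ac)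
qed

lemma binom_expect_const: "binom_expect p n (\<lambda>_. c) = c"
proof -
  have "(\<Sum>D\<le>n. binom_mass p n D) = (p + (1 - p))^n"
    unfolding binom_mass_def binomial_ring by simp
  thus ?thesis by (simp add: binom_expect_def sum_distrib_right[symmetric])
qed

lemma binom_mass_flip: "D \<le> n \<Longrightarrow> binom_mass p n (n - D) = binom_mass (1 - p) n D"
  by (simp add: binom_mass_def binomial_symmetric[symmetric])

lemma binom_expect_flip: "binom_expect p n (\<lambda>D. f (n - D)) = binom_expect (1 - p) n f"
  unfolding binom_expect_def
  by (rule sum.reindex_bij_witness[of _ "\<lambda>D. n - D" "\<lambda>D. n - D"])
     (auto simp: binom_mass_flip)

text \<open>Absorption: a factor 1/(D+1) turns the mass into one for n+1 trials. Iterated, it makes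
  inverse factorial moments into sums of shifted masses, which are at most 1.\<close>

lemma binom_mass_Suc:
  assumes "p \<noteq> 0"
  shows "binom_mass p n D / (real D + 1) = binom_mass p (Suc n) (Suc D) / ((real n + 1) * p)"
proof -
  have "real (Suc D * (Suc n choose Suc D)) = real (Suc n * (n choose D))"
    by (simp only: Suc_times_binomial)
  hence e: "real (n choose D) / (real D + 1) = real (Suc n choose Suc D) / (real n + 1)"
    by (simp add: field_simps del: binomial_Suc_Suc)
  have "binom_mass p n D / (real D + 1) = real (n choose D) / (real D + 1) * (p^D * (1-p)^(n-D))"
    by (simp add: binom_mass_def)
  also have "\<dots> = binom_mass p (Suc n) (Suc D) / ((real n + 1) * p)"
    unfolding e using assms by (simp add: binom_mass_def del: binomial_Suc_Suc)
  finally show ?thesis .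
qed

lemma binom_mass_Suc2:
  assumes p: "p \<noteq> 0"
  shows "binom_mass p n D * (1 / ((real D + 1) * (real D + 2)))
     = binom_mass p (n+2) (D+2) / ((real n + 1) * (real n + 2) * p^2)"
proof -
  have m: "binom_mass p (Suc n) (Suc D) / (real D + 2) = binom_mass p (n+2) (D+2) / ((real n + 2) * p)"
    using binom_mass_Suc[OF p, of "Suc n" "Suc D"] by (simp add: add.commute)
  have "binom_mass p n D * (1 / ((real D + 1) * (real D + 2))) = binom_mass p n D / (real D + 1) / (real D + 2)"
    by simp
  also have "\<dots> = binom_mass p (Suc n) (Suc D) / (real D + 2) / ((real n + 1) * p)"
    by (simp only: binom_mass_Suc[OF p] divide_divide_eq_left mult.commute)
  also have "\<dots> = binom_mass p (n+2) (D+2) / ((real n + 2) * p) / ((real n + 1) * p)" by (simp only: m)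
  also have "\<dots> = binom_mass p (n+2) (D+2) / ((real n + 1) * (real n + 2) * p^2)"
    by (simp only: divide_divide_eq_left power2_eq_square mult_ac)
  finally show ?thesis .
qed

lemma sum_binom_mass: "(\<Sum>D\<le>n. binom_mass p n D) = 1"
  using binom_expect_const[of p n 1] by (simp add: binom_expect_def)

lemma sum_binom_mass_shift:
  assumes "0 < p" "p < 1"
  shows "(\<Sum>D\<le>n. binom_mass p (n+k) (D+k)) \<le> 1"
proof -
  have "(\<Sum>D\<le>n. binom_mass p (n+k) (D+k)) = (\<Sum>D\<in>(\<lambda>D. D+k) ` {..n}. binom_mass p (n+k) D)"
    by (subst sum.reindex) (auto simp: inj_on_def)
  also have "\<dots> \<le> (\<Sum>D\<le>n+k. binom_mass p (n+k) D)"
    by (rule sum_mono2) (auto intro: binom_mass_nonneg assms)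
  finally show ?thesis by (simp add: sum_binom_mass)
qed

lemma binom_expect_inverse:
  assumes "p \<noteq> 0"
  shows "binom_expect p n (\<lambda>D. 1 / (real D + 1)) = (1 - (1-p)^Suc n) / ((real n + 1) * p)"
proof -
  have "(\<Sum>D\<le>Suc n. binom_mass p (Suc n) D) = 1" by (rule sum_binom_mass)
  hence "(\<Sum>D\<le>n. binom_mass p (Suc n) (Suc D)) = 1 - (1-p)^Suc n"
    by (simp only: sum.atMost_Suc_shift) (simp add: binom_mass_def)
  thus ?thesis
    by (simp add: binom_expect_def binom_mass_Suc[OF assms] sum_divide_distrib[symmetric])
qed

lemma binom_expect_inverse_le:
  assumes "0 < p" "p < 1"
  shows "binom_expect p n (\<lambda>D. 1 / (real D + 1)) \<le> 1 / ((real n + 1) * p)"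
  unfolding binom_expect_inverse[OF less_imp_neq[OF assms(1), symmetric]]
  using assms by (intro divide_right_mono) auto

lemma binom_expect_inverse2_le:
  assumes "0 < p" "p < 1"
  shows "binom_expect p n (\<lambda>D. 1 / ((real D + 1) * (real D + 2))) \<le> 1 / ((real n + 1) * (real n + 2) * p^2)"
proof -
  have p: "p \<noteq> 0" using assms by simp
  have "binom_mass p n D * (1 / ((real D + 1) * (real D + 2)))
     = binom_mass p (n+2) (D+2) / ((real n + 1) * (real n + 2) * p^2)" for D
    by (rule binom_mass_Suc2[OF p])
  hence "binom_expect p n (\<lambda>D. 1 / ((real D + 1) * (real D + 2)))
     = (\<Sum>D\<le>n. binom_mass p (n+2) (D+2)) / ((real n + 1) * (real n + 2) * p^2)"
    by (simp only: binom_expect_def sum_divide_distrib)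
  also have "\<dots> \<le> 1 / ((real n + 1) * (real n + 2) * p^2)"
    by (intro divide_right_mono sum_binom_mass_shift assms) auto
  finally show ?thesis .
qed

lemma binom_expect_inverse3_le:
  assumes "0 < p" "p < 1"
  shows "binom_expect p n (\<lambda>D. 1 / ((real D + 1) * (real D + 2) * (real D + 3)))
    \<le> 1 / ((real n + 1) * (real n + 2) * (real n + 3) * p^3)"
proof -
  have p: "p \<noteq> 0" using assms by simp
  have "binom_mass p n D * (1 / ((real D + 1) * (real D + 2) * (real D + 3)))
     = binom_mass p (n+3) (D+3) / ((real n + 1) * (real n + 2) * (real n + 3) * p^3)" for D
  proof -
    have m: "binom_mass p (n+2) (D+2) / (real D + 3) = binom_mass p (n+3) (D+3) / ((real n + 3) * p)"
      using binom_mass_Suc[OF p, of "n+2" "D+2"] by (simp add: add.commute numeral_3_eq_3)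
    have "binom_mass p n D * (1 / ((real D + 1) * (real D + 2) * (real D + 3)))
       = binom_mass p n D * (1 / ((real D + 1) * (real D + 2))) / (real D + 3)" by simp
    also have "\<dots> = binom_mass p (n+2) (D+2) / (real D + 3) / ((real n + 1) * (real n + 2) * p^2)"
      by (simp only: binom_mass_Suc2[OF p] divide_divide_eq_left mult.commute)
    also have "\<dots> = binom_mass p (n+3) (D+3) / ((real n + 3) * p) / ((real n + 1) * (real n + 2) * p^2)"
      by (simp only: m)
    also have "\<dots> = binom_mass p (n+3) (D+3) / ((real n + 1) * (real n + 2) * (real n + 3) * p^3)"
      by (simp only: divide_divide_eq_left power2_eq_square power3_eq_cube mult_ac)
    finally show ?thesis .
  qed
  hence "binom_expect p n (\<lambda>D. 1 / ((real D + 1) * (real D + 2) * (real D + 3)))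
     = (\<Sum>D\<le>n. binom_mass p (n+3) (D+3)) / ((real n + 1) * (real n + 2) * (real n + 3) * p^3)"
    by (simp only: binom_expect_def sum_divide_distrib)
  also have "\<dots> \<le> 1 / ((real n + 1) * (real n + 2) * (real n + 3) * p^3)"
    using assms by (intro divide_right_mono sum_binom_mass_shift assms) auto
  finally show ?thesis .
qed

lemma binom_expect_inverse_square_le:
  assumes "0 < p" "p < 1"
  shows "binom_expect p n (\<lambda>D. 1 / (real D + 1)^2)
    \<le> 1 / ((real n + 1) * (real n + 2) * p^2) + 3 / ((real n + 1) * (real n + 2) * (real n + 3) * p^3)"
proof -
  \<comment> \<open>The leading coefficient has to be exactly 1, because the variance estimate for
    n/(D+1) relies on cancellation of the leading terms. The 3 is the value of (x+2)/x at x = 1,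
    that is at D = 0, the worst case.\<close>
  have "1 / (real D + 1)^2 \<le> 1 / ((real D + 1) * (real D + 2)) + 3 * (1 / ((real D + 1) * (real D + 2) * (real D + 3)))" for D
  proof -
    have "1 / x^2 \<le> 1 / (x * (x + 1)) + 3 * (1 / (x * (x+1) * (x+2)))" if "x \<ge> 1" for x :: real
    proof -
      have nonneg: "x * (x + 2) + 3 * x - (x + 1) * (x + 2) \<ge> 0" using that by (simp add: algebra_simps)
      have "1 / (x * (x + 1)) + 3 * (1 / (x * (x+1) * (x+2))) - 1 / x^2 
         = (x * (x + 2) + 3 * x - (x + 1) * (x + 2)) / (x^2 * (x+1) * (x+2))"
        using that by (simp add: divide_simps power2_eq_square) (simp add: algebra_simps)
      moreover have "0 \<le> (x * (x + 2) + 3 * x - (x + 1) * (x + 2)) / (x^2 * (x+1) * (x+2))"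
        using that nonneg by (intro divide_nonneg_nonneg mult_nonneg_nonneg) auto
      ultimately show ?thesis by linarith
    qed
    from this[of "real D + 1"] show ?thesis by (simp add: algebra_simps)
  qed
  hence "binom_expect p n (\<lambda>D. 1 / (real D + 1)^2)
     \<le> binom_expect p n (\<lambda>D. 1 / ((real D + 1) * (real D + 2)) + 3 * (1 / ((real D + 1) * (real D + 2) * (real D + 3))))"
    by (intro binom_expect_mono assms)
  also have "\<dots> = binom_expect p n (\<lambda>D. 1 / ((real D + 1) * (real D + 2)))
      + 3 * binom_expect p n (\<lambda>D. 1 / ((real D + 1) * (real D + 2) * (real D + 3)))"
    by (simp only: binom_expect_add binom_expect_cmult)
  also have "\<dots> \<le> 1 / ((real n + 1) * (real n + 2) * p^2) + 3 * (1 / ((real n + 1) * (real n + 2) * (real n + 3) * p^3))"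
    by (intro add_mono mult_left_mono binom_expect_inverse2_le binom_expect_inverse3_le assms) auto
  finally show ?thesis by simp
qed

section \<open>Concentration of the reciprocal of a binomial count\<close>

lemma tendsto_0_if_le_eps:
  fixes a b :: "nat \<Rightarrow> real"
  assumes "\<And>n. 0 \<le> a n" "b \<longlonglongrightarrow> 0" "\<And>\<epsilon> n. \<epsilon> > 0 \<Longrightarrow> a n \<le> C * \<epsilon> + c \<epsilon> * b n"
  shows "a \<longlonglongrightarrow> 0"
proof (rule LIMSEQ_I)
  fix r :: real assume r: "r > 0"
  \<comment> \<open>\<epsilon> is fixed before n grows, so \<open>c \<epsilon>\<close> may be
    arbitrarily large. The added 1 keeps the denominator positive when C = 0.\<close>
  define \<epsilon> where "\<epsilon> = r / (2 * (\<bar>C\<bar> + 1))"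
  have e: "\<epsilon> > 0" using r by (auto simp: \<epsilon>_def)
  have "C * \<epsilon> \<le> \<bar>C\<bar> * \<epsilon>" using e by (intro mult_right_mono) auto
  also have "\<dots> < (\<bar>C\<bar> + 1) * \<epsilon>" using e by simp
  also have "\<dots> = r / 2" 
  proof -
    have "\<bar>C\<bar> + 1 \<noteq> 0" "2 * \<bar>C\<bar> + 2 \<noteq> 0" by linarith+
    thus ?thesis unfolding \<epsilon>_def by (simp add: field_simps)
  qed
  finally have "C * \<epsilon> < r/2" .
  have "(\<lambda>n. c \<epsilon> * b n) \<longlonglongrightarrow> 0" using tendsto_mult_right_zero[OF assms(2)] .
  from LIMSEQ_D[OF this, of "r/2"] r obtain N where N: "\<forall>n\<ge>N. \<bar>c \<epsilon> * b n\<bar> < r/2" by auto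
  have "a n < r" if "n \<ge> N" for n
  proof -
    have "c \<epsilon> * b n < r/2" using N that abs_less_iff by blast
    thus ?thesis using assms(3)[OF e, of n] \<open>C * \<epsilon> < r/2\<close> by linarith
  qed
  thus "\<exists>N. \<forall>n\<ge>N. norm (a n - 0) < r" using assms(1) by auto
qed

text \<open>Chebyshev's argument for n/(D+1) instead of D/n, since the point probabilities involve D
  through its reciprocal. The second moment about 1/p is at most \<open>b n\<close>, whose parts
  tend to 1/p^2 - 2/p^2 + 1/p^2 = 0.\<close>

lemma binom_law_of_large_numbers:
  assumes p: "0 < p" "p < 1"
  shows "(\<lambda>n. binom_expect p n (\<lambda>D. \<bar>real n / (real D + 1) - 1 / p\<bar>)) \<longlonglongrightarrow> 0"
proof -
  define b where "b n = (real n)^2 * (1 / ((real n + 1) * (real n + 2) * p^2)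
       + 3 / ((real n + 1) * (real n + 2) * (real n + 3) * p^3))
      - 2 * real n / p * ((1 - (1-p)^Suc n) / ((real n + 1) * p)) + 1 / p^2" for n
  have le: "binom_expect p n (\<lambda>D. (real n / (real D + 1) - 1 / p)^2) \<le> b n" for n
  proof -
    have "(real n / (real D + 1) - 1 / p)^2 = (real n)^2 * (1 / (real D + 1)^2)
        - (2 * real n / p * (1 / (real D + 1)) - 1 / p^2)" for D
      by (simp add: power2_diff power_divide)
    hence "binom_expect p n (\<lambda>D. (real n / (real D + 1) - 1 / p)^2) = 
       (real n)^2 * binom_expect p n (\<lambda>D. 1 / (real D + 1)^2)
        - (2 * real n / p * binom_expect p n (\<lambda>D. 1 / (real D + 1)) - 1 / p^2)"
      by (simp only: binom_expect_diff binom_expect_cmult binom_expect_const)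
    also have "\<dots> \<le> b n"
      using mult_left_mono[OF binom_expect_inverse_square_le[OF p, of n], of "(real n)^2"] p
      by (simp add: b_def binom_expect_inverse)
    finally show ?thesis .
  qed
  have b0: "b \<longlonglongrightarrow> 0"
  proof -
    have "(\<lambda>n. (1-p)^Suc n) \<longlonglongrightarrow> 0" using p by (intro LIMSEQ_Suc LIMSEQ_power_zero) auto
    moreover have "(\<lambda>n. (real n)^2 / ((real n + 1) * (real n + 2))) \<longlonglongrightarrow> 1" by real_asymp
    moreover have "(\<lambda>n. 3 * (real n)^2 / ((real n + 1) * (real n + 2) * (real n + 3))) \<longlonglongrightarrow> 0" by real_asymp
    moreover have "(\<lambda>n. 2 * real n / (real n + 1)) \<longlonglongrightarrow> 2" by real_asymp
    ultimately have "(\<lambda>n. (real n)^2 / ((real n + 1) * (real n + 2)) * (1 / p^2)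
        + 3 * (real n)^2 / ((real n + 1) * (real n + 2) * (real n + 3)) * (1 / p^3)
        - 2 * real n / (real n + 1) * (1 - (1-p)^Suc n) * (1 / p^2) + 1 / p^2) \<longlonglongrightarrow>
        1 * (1 / p^2) + 0 * (1/p^3) - 2 * (1 - 0) * (1 / p^2) + 1 / p^2"
      by (intro tendsto_intros)
    moreover have "(real n)^2 / ((real n + 1) * (real n + 2)) * (1 / p^2)
        + 3 * (real n)^2 / ((real n + 1) * (real n + 2) * (real n + 3)) * (1 / p^3)
        - 2 * real n / (real n + 1) * (1 - (1-p)^Suc n) * (1 / p^2) + 1 / p^2 = b n" for n
    proof -
      have "N^2 * (1 / (X * P) + 3 / (Y * R)) - 2 * N / p * (e / (Z * p)) + 1 / p^2
         = N^2 / X * (1 / P) + 3 * N^2 / Y * (1 / R) - 2 * N / Z * e * (1 / p^2) + 1 / p^2"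
        for N X P Y R Z e :: real by (simp add: distrib_left power2_eq_square mult_ac)
      thus ?thesis by (simp only: b_def)
    qed
    ultimately show ?thesis by simp
  qed
  show ?thesis
  proof (rule tendsto_0_if_le_eps[OF _ b0, where C = 1 and c = "\<lambda>\<epsilon>. 1 / \<epsilon>"])
    show "0 \<le> binom_expect p n (\<lambda>D. \<bar>real n / (real D + 1) - 1 / p\<bar>)" for n
      by (intro binom_expect_nonneg p) auto
    fix \<epsilon> :: real and n assume e: "\<epsilon> > 0"
    \<comment> \<open>Replaces the Cauchy-Schwarz inequality in passing from the second moment to
      the first.\<close>
    have "\<bar>x\<bar> \<le> \<epsilon> + 1 / \<epsilon> * x^2" for x :: real
    proof (cases "\<bar>x\<bar> \<le> \<epsilon>")
      case False
      hence "\<bar>x\<bar> * \<epsilon> \<le> \<bar>x\<bar> * \<bar>x\<bar>" by (intro mult_left_mono) auto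
      hence "\<bar>x\<bar> \<le> 1 / \<epsilon> * x^2" using e by (simp add: field_simps power2_eq_square)
      thus ?thesis using e by linarith
    qed (use e in \<open>auto intro!: add_increasing2\<close>)
    hence "binom_expect p n (\<lambda>D. \<bar>real n / (real D + 1) - 1 / p\<bar>) 
      \<le> binom_expect p n (\<lambda>D. \<epsilon> + 1 / \<epsilon> * (real n / (real D + 1) - 1 / p)^2)"
      by (intro binom_expect_mono p)
    also have "\<dots> = \<epsilon> + 1 / \<epsilon> * binom_expect p n (\<lambda>D. (real n / (real D + 1) - 1 / p)^2)"
      by (simp only: binom_expect_add binom_expect_cmult binom_expect_const)
    also have "\<dots> \<le> 1 * \<epsilon> + 1 / \<epsilon> * b n"
      using e by (intro add_mono mult_left_mono le) auto
    finally show "binom_expect p n (\<lambda>D. \<bar>real n / (real D + 1) - 1 / p\<bar>) \<le> 1 * \<epsilon> + 1 / \<epsilon> * b n" .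
  qed
qed

section \<open>Weights of products of two point probabilities, large near D = 0 and D = n\<close>

definition edge_weight :: "nat \<Rightarrow> nat \<Rightarrow> real" where
  "edge_weight n D = 1 / (sqrt (real D + 1) * sqrt (real (n - D) + 1))"

lemma edge_weight_nonneg: "0 \<le> edge_weight n D"
  by (simp add: edge_weight_def)

lemma edge_weight_flip: "D \<le> n \<Longrightarrow> edge_weight n (n - D) = edge_weight n D"
  by (simp add: edge_weight_def mult.commute)

lemma edge_weight_square: "(edge_weight n D)^2 = 1 / ((real D + 1) * (real (n - D) + 1))"
  by (simp add: edge_weight_def power_mult_distrib power_divide)

text \<open>Partial fractions: the two denominators add up to n + 2. The squared weight becomes a
  sum of one-sided reciprocals, to which the law of large numbers applies separately for D and n -
  D.\<close>

lemma edge_weight_square_split: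
  assumes "D \<le> n"
  shows "(edge_weight n D)^2 = 1 / (real n + 2) * (1 / (real D + 1) + 1 / (real (n - D) + 1))"
  using assms by (simp add: edge_weight_square divide_simps of_nat_diff)

lemma edge_weight_le: "edge_weight n D \<le> (1/2) * (1 / (real D + 1)) + (1/2) * (1 / (real (n - D) + 1))"
proof -
  define a b where "a = 1 / sqrt (real D + 1)" and "b = 1 / sqrt (real (n - D) + 1)"
  have "edge_weight n D = a * b" "1 / (real D + 1) = a^2" "1 / (real (n - D) + 1) = b^2"
    by (simp_all add: edge_weight_def a_def b_def power_divide)
  thus ?thesis using sum_squares_bound[of a b] by (simp add: power2_eq_square)
qed

lemma n_binom_expect_edge_weight_le:
  assumes p: "0 < p" "p < 1"
  shows "real n * binom_expect p n (edge_weight n) \<le> 1 / (2 * p * (1 - p))"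
proof -
  have q: "0 < 1 - p" "1 - p < 1" using p by auto
  have "binom_expect p n (edge_weight n) \<le>
     binom_expect p n (\<lambda>D. (1/2) * (1 / (real D + 1)) + (1/2) * (1 / (real (n - D) + 1)))"
    by (intro binom_expect_mono p edge_weight_le)
  also have "\<dots> = (1/2) * binom_expect p n (\<lambda>D. 1 / (real D + 1))
      + (1/2) * binom_expect (1-p) n (\<lambda>D. 1 / (real D + 1))"
    unfolding binom_expect_add binom_expect_cmult
    using binom_expect_flip[of p n "\<lambda>D. 1 / (real D + 1)"] by simp
  also have "\<dots> \<le> (1/2) * (1 / ((real n + 1) * p)) + (1/2) * (1 / ((real n + 1) * (1 - p)))"
    by (intro add_mono mult_left_mono binom_expect_inverse_le p q) auto
  also have "\<dots> = 1 / (2 * p * (1 - p)) / (real n + 1)"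
  proof -
    have "(1/2) * (1 / (N * p)) + (1/2) * (1 / (N * (1 - p))) = 1 / (2 * p * (1 - p)) / N" if "N > 0" for N
      using that p by (simp add: divide_simps)
    thus ?thesis by simp
  qed
  finally have "real n * binom_expect p n (edge_weight n) \<le> real n * (1 / (2 * p * (1 - p)) / (real n + 1))"
    by (intro mult_left_mono) auto
  also have "\<dots> = 1 / (2 * p * (1 - p)) * (real n / (real n + 1))" by simp
  also have "\<dots> \<le> 1 / (2 * p * (1 - p)) * 1"
    using p by (intro mult_left_mono) auto
  finally show ?thesis by simp
qed

text \<open>One extra factor 1/(D+1) makes the scaled mean O(1/n), which shows that small D do not
  matter. With a and b the reciprocal roots at the two ends, the integrand a^3 b is at most a^4 +
  b^4, a sum of inverse squares.\<close>

lemma binom_expect_edge_weight_div_le: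
  assumes p: "0 < p" "p < 1"
  shows "real n * binom_expect p n (\<lambda>D. edge_weight n D / (real D + 1))
      \<le> real n * ((1/p^2 + 3/p^3 + 1/(1-p)^2 + 3/(1-p)^3) / ((real n + 1) * (real n + 2)))"
proof -
  have q: "0 < 1 - p" "1 - p < 1" using p by auto
  have le: "edge_weight n D / (real D + 1) \<le> 1 / (real D + 1)^2 + 1 / (real (n - D) + 1)^2" for D
  proof -
    define a b where "a = 1 / sqrt (real D + 1)" and "b = 1 / sqrt (real (n - D) + 1)"
    have ab: "0 \<le> a" "0 \<le> b" by (auto simp: a_def b_def)
    have "a^2 = 1 / (real D + 1)" "b^2 = 1 / (real (n - D) + 1)" by (simp_all add: a_def b_def power_divide)
    hence e: "1 / (real D + 1)^2 = a^2 * a^2" "1 / (real (n - D) + 1)^2 = b^2 * b^2"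
        "edge_weight n D / (real D + 1) = a * b * a^2"
      by (simp_all add: edge_weight_def a_def b_def power2_eq_square)
    show ?thesis
    proof (cases "a \<le> b")
      case True
      hence "a * b * a^2 \<le> b * b * b^2" using ab by (intro mult_mono power_mono) auto
      thus ?thesis unfolding e by (simp add: power2_eq_square add_increasing)
    next
      case False
      hence "a * b * a^2 \<le> a * a * a^2" using ab by (intro mult_mono power_mono) auto
      thus ?thesis unfolding e by (simp add: power2_eq_square add_increasing2)
    qed
  qed
  have E: "binom_expect r n (\<lambda>D. 1 / (real D + 1)^2) \<le> (1/r^2 + 3/r^3) / ((real n + 1) * (real n + 2))"
    if r: "0 < r" "r < 1" for r
  proof -
    have "binom_expect r n (\<lambda>D. 1 / (real D + 1)^2) 
      \<le> 1 / ((real n + 1) * (real n + 2) * r^2) + 3 / ((real n + 1) * (real n + 2) * (real n + 3) * r^3)"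
      by (rule binom_expect_inverse_square_le[OF r])
    also have "\<dots> \<le> 1 / ((real n + 1) * (real n + 2) * r^2) + 3 / ((real n + 1) * (real n + 2) * 1 * r^3)"
      using r by (intro add_mono divide_left_mono mult_mono mult_right_mono mult_left_mono mult_pos_pos) auto
    also have "\<dots> = (1/r^2 + 3/r^3) / ((real n + 1) * (real n + 2))"
      by (simp add: add_divide_distrib mult.commute)
    finally show ?thesis .
  qed
  have "binom_expect p n (\<lambda>D. edge_weight n D / (real D + 1)) 
    \<le> binom_expect p n (\<lambda>D. 1 / (real D + 1)^2 + 1 / (real (n - D) + 1)^2)"
    by (intro binom_expect_mono p le)
  also have "\<dots> = binom_expect p n (\<lambda>D. 1 / (real D + 1)^2) + binom_expect (1-p) n (\<lambda>D. 1 / (real D + 1)^2)"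
    unfolding binom_expect_add using binom_expect_flip[of p n "\<lambda>D. 1 / (real D + 1)^2"] by simp
  also have "\<dots> \<le> (1/p^2 + 3/p^3) / ((real n + 1) * (real n + 2)) + (1/(1-p)^2 + 3/(1-p)^3) / ((real n + 1) * (real n + 2))"
    by (intro add_mono E p q)
  also have "\<dots> = (1/p^2 + 3/p^3 + 1/(1-p)^2 + 3/(1-p)^3) / ((real n + 1) * (real n + 2))"
    by (simp add: add_divide_distrib)
  finally show ?thesis by (intro mult_left_mono) auto
qed

text \<open>An error that is small only for large D still averages out. Below the index K from which
  |g| is at most \<epsilon> one has 1 \<le> K/(D+1), so the exceptional D are paid for by the extra
  reciprocal factor.\<close>

lemma edge_weight_error_tendsto_0:
  assumes p: "0 < p" "p < 1" and g: "g \<longlonglongrightarrow> 0"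
  shows "(\<lambda>n. real n * binom_expect p n (\<lambda>D. edge_weight n D * \<bar>g D\<bar>)) \<longlonglongrightarrow> 0"
proof -
  have "Bseq g" using g by (intro convergent_imp_Bseq) (auto simp: convergent_def)
  then obtain G where G: "G > 0" "\<And>D. \<bar>g D\<bar> \<le> G" by (auto simp: Bseq_def)
  have "\<exists>K. \<forall>D\<ge>K. \<bar>g D\<bar> \<le> \<epsilon>" if "\<epsilon> > 0" for \<epsilon>
    using LIMSEQ_D[OF g that] by (auto intro: less_imp_le)
  then obtain K where K: "\<And>\<epsilon> D. \<epsilon> > 0 \<Longrightarrow> D \<ge> K \<epsilon> \<Longrightarrow> \<bar>g D\<bar> \<le> \<epsilon>" by metis
  define b where "b n = real n * ((1/p^2 + 3/p^3 + 1/(1-p)^2 + 3/(1-p)^3) / ((real n + 1) * (real n + 2)))" for n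
  have b0: "b \<longlonglongrightarrow> 0" unfolding b_def by real_asymp
  show ?thesis
  proof (rule tendsto_0_if_le_eps[OF _ b0, where C = "1 / (2 * p * (1 - p))" and c = "\<lambda>\<epsilon>. G * real (K \<epsilon>)"])
    show "0 \<le> real n * binom_expect p n (\<lambda>D. edge_weight n D * \<bar>g D\<bar>)" for n
      by (intro mult_nonneg_nonneg binom_expect_nonneg p) (auto simp: edge_weight_nonneg)
    fix \<epsilon> :: real and n assume e: "\<epsilon> > 0"
    have le: "\<bar>g D\<bar> \<le> \<epsilon> + G * real (K \<epsilon>) / (real D + 1)" for D
    proof (cases "D \<ge> K \<epsilon>")
      case True
      thus ?thesis using K[OF e True] G(1) by (intro add_increasing2) auto
    next
      case False
      hence "1 \<le> real (K \<epsilon>) / (real D + 1)" by simp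
      hence "G * 1 \<le> G * (real (K \<epsilon>) / (real D + 1))" using G by (intro mult_left_mono) auto
      thus ?thesis using G(2)[of D] e by simp
    qed
    have "binom_expect p n (\<lambda>D. edge_weight n D * \<bar>g D\<bar>)
       \<le> binom_expect p n (\<lambda>D. \<epsilon> * edge_weight n D + G * real (K \<epsilon>) * (edge_weight n D / (real D + 1)))"
    proof (intro binom_expect_mono p)
      fix D
      have "edge_weight n D * \<bar>g D\<bar> \<le> edge_weight n D * (\<epsilon> + G * real (K \<epsilon>) / (real D + 1))"
        by (intro mult_left_mono le edge_weight_nonneg)
      thus "edge_weight n D * \<bar>g D\<bar> \<le> \<epsilon> * edge_weight n D + G * real (K \<epsilon>) * (edge_weight n D / (real D + 1))"
        by (simp add: algebra_simps)
    qed
    also have "\<dots> = \<epsilon> * binom_expect p n (edge_weight n)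
        + G * real (K \<epsilon>) * binom_expect p n (\<lambda>D. edge_weight n D / (real D + 1))"
      by (simp only: binom_expect_add binom_expect_cmult)
    finally have "real n * binom_expect p n (\<lambda>D. edge_weight n D * \<bar>g D\<bar>) \<le> real n * \<dots>"
      by (intro mult_left_mono) auto
    also have "\<dots> = \<epsilon> * (real n * binom_expect p n (edge_weight n))
        + G * real (K \<epsilon>) * (real n * binom_expect p n (\<lambda>D. edge_weight n D / (real D + 1)))"
      by (simp add: algebra_simps)
    also have "\<dots> \<le> \<epsilon> * (1 / (2 * p * (1 - p))) + G * real (K \<epsilon>) * b n"
      unfolding b_def using e G
      by (intro add_mono mult_left_mono n_binom_expect_edge_weight_le binom_expect_edge_weight_div_le p) auto
    finally show "real n * binom_expect p n (\<lambda>D. edge_weight n D * \<bar>g D\<bar>)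
      \<le> 1 / (2 * p * (1 - p)) * \<epsilon> + G * real (K \<epsilon>) * b n" by (simp add: mult.commute)
  qed
qed

lemma edge_weight_error_tendsto_0_flip:
  assumes p: "0 < p" "p < 1" and g: "g \<longlonglongrightarrow> 0"
  shows "(\<lambda>n. real n * binom_expect p n (\<lambda>D. edge_weight n D * \<bar>g (n - D)\<bar>)) \<longlonglongrightarrow> 0"
proof -
  have "binom_expect p n (\<lambda>D. edge_weight n D * \<bar>g (n - D)\<bar>)
      = binom_expect (1-p) n (\<lambda>D. edge_weight n D * \<bar>g D\<bar>)" for n
  proof -
    have "binom_expect p n (\<lambda>D. edge_weight n D * \<bar>g (n - D)\<bar>) 
        = binom_expect p n (\<lambda>D. (\<lambda>E. edge_weight n E * \<bar>g E\<bar>) (n - D))"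
      unfolding binom_expect_def by (intro sum.cong) (auto simp: edge_weight_flip)
    also have "\<dots> = binom_expect (1-p) n (\<lambda>E. edge_weight n E * \<bar>g E\<bar>)"
      by (rule binom_expect_flip)
    finally show ?thesis .
  qed
  thus ?thesis using edge_weight_error_tendsto_0[of "1 - p" g] p g by simp
qed

text \<open>The square of n times the weight is close to n/(D+1) + n/(n-D+1), hence to 1/p + 1/(1-p)
  = 1/(p(1-p)). The root is removed by \<kappa> |V - \<kappa>| \<le> |V^2 - \<kappa>^2| for V \<ge>
  0.\<close>

lemma edge_weight_L1:
  assumes p: "0 < p" "p < 1"
  shows "(\<lambda>n. binom_expect p n (\<lambda>D. \<bar>real n * edge_weight n D - 1 / sqrt (p * (1 - p))\<bar>)) \<longlonglongrightarrow> 0"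
proof -
  have q: "0 < 1 - p" "1 - p < 1" using p by auto
  define \<kappa> where "\<kappa> = 1 / sqrt (p * (1 - p))"
  have \<kappa>: "\<kappa> > 0" "\<kappa>^2 = 1 / p + 1 / (1 - p)"
    using p by (auto simp: \<kappa>_def power_divide divide_simps)
  let ?l = "\<lambda>r n. binom_expect r n (\<lambda>D. \<bar>real n / (real D + 1) - 1 / r\<bar>)"
  let ?i = "\<lambda>r n. binom_expect r n (\<lambda>D. 1 / (real D + 1))"
  let ?c = "\<lambda>n. 2 * real n / (real n + 2)"
  define U where "U n = 1 / \<kappa> * (?l p n + ?l (1-p) n + 2 * (?i p n + ?i (1-p) n))" for n
  have i0: "?i r \<longlonglongrightarrow> 0" if "0 < r" "r < 1" for r
  proof (rule tendsto_sandwich[OF _ _ tendsto_const])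
    show "(\<lambda>n. 1 / ((real n + 1) * r)) \<longlonglongrightarrow> 0" using that by real_asymp
    show "\<forall>\<^sub>F n in sequentially. ?i r n \<le> 1 / ((real n + 1) * r)"
      using binom_expect_inverse_le[OF that] by simp
    show "\<forall>\<^sub>F n in sequentially. 0 \<le> ?i r n"
      using binom_expect_nonneg[OF that] by simp
  qed
  have "U \<longlonglongrightarrow> 1 / \<kappa> * (0 + 0 + 2 * (0 + 0))"
    unfolding U_def by (intro tendsto_intros binom_law_of_large_numbers i0 p q)
  hence U0: "U \<longlonglongrightarrow> 0" by simp
  have "binom_expect p n (\<lambda>D. \<bar>real n * edge_weight n D - \<kappa>\<bar>) \<le> U n" for n
  proof -
    have le: "\<bar>real n * edge_weight n D - \<kappa>\<bar> \<le> 1 / \<kappa> * ((\<bar>real n / (real D + 1) - 1 / p\<bar>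
         + \<bar>real n / (real (n - D) + 1) - 1 / (1 - p)\<bar>) + 2 * (1 / (real D + 1) + 1 / (real (n - D) + 1)))"
      if D: "D \<le> n" for D
    proof -
      define V where "V = real n * edge_weight n D"
      define s where "s = 1 / (real D + 1) + 1 / (real (n - D) + 1)"
      have V: "V \<ge> 0" by (simp add: V_def edge_weight_nonneg)
      have s: "s \<ge> 0" by (simp add: s_def)
      have "V^2 = (real n)^2 * (1 / (real n + 2) * s)"
        by (simp only: V_def s_def power_mult_distrib edge_weight_square_split[OF D])
      also have "\<dots> = real n * s - ?c n * s"
        by (simp add: field_simps power2_eq_square)
      finally have V2: "V^2 = real n * s - ?c n * s" .
      have "?c n * s \<le> 2 * s" using s by (intro mult_right_mono) (auto simp: divide_simps)
      moreover have "0 \<le> ?c n * s" using s by simp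
      moreover have "real n * s - \<kappa>^2 = (real n / (real D + 1) - 1 / p) + (real n / (real (n - D) + 1) - 1 / (1 - p))"
        unfolding \<kappa> s_def by (simp add: algebra_simps)
      ultimately have "\<bar>V^2 - \<kappa>^2\<bar>
          \<le> \<bar>real n / (real D + 1) - 1 / p\<bar> + \<bar>real n / (real (n - D) + 1) - 1 / (1 - p)\<bar> + 2 * s"
        unfolding V2 by linarith
      moreover have "\<kappa> * \<bar>V - \<kappa>\<bar> \<le> \<bar>V^2 - \<kappa>^2\<bar>"
      proof -
        have "V^2 - \<kappa>^2 = (V + \<kappa>) * (V - \<kappa>)" by (simp add: power2_eq_square algebra_simps)
        hence "\<bar>V^2 - \<kappa>^2\<bar> = (V + \<kappa>) * \<bar>V - \<kappa>\<bar>" using V \<kappa> by (simp add: abs_mult)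
        thus ?thesis using V by (simp add: mult_right_mono)
      qed
      ultimately have "\<kappa> * \<bar>V - \<kappa>\<bar>
          \<le> \<bar>real n / (real D + 1) - 1 / p\<bar> + \<bar>real n / (real (n - D) + 1) - 1 / (1 - p)\<bar> + 2 * s"
        by linarith
      hence "1 / \<kappa> * (\<kappa> * \<bar>V - \<kappa>\<bar>)
          \<le> 1 / \<kappa> * (\<bar>real n / (real D + 1) - 1 / p\<bar> + \<bar>real n / (real (n - D) + 1) - 1 / (1 - p)\<bar> + 2 * s)"
        using \<kappa> by (intro mult_left_mono) auto
      thus ?thesis using \<kappa> by (simp add: V_def s_def)
    qed
    have "binom_expect p n (\<lambda>D. \<bar>real n * edge_weight n D - \<kappa>\<bar>)
        \<le> binom_expect p n (\<lambda>D. 1 / \<kappa> * ((\<bar>real n / (real D + 1) - 1 / p\<bar>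
         + \<bar>real n / (real (n - D) + 1) - 1 / (1 - p)\<bar>) + 2 * (1 / (real D + 1) + 1 / (real (n - D) + 1))))"
      by (intro binom_expect_mono p le)
    also have "\<dots> = U n"
      unfolding U_def binom_expect_cmult binom_expect_add
      using binom_expect_flip[of p n "\<lambda>D. \<bar>real n / (real D + 1) - 1 / (1 - p)\<bar>"]
        binom_expect_flip[of p n "\<lambda>D. 1 / (real D + 1)"] by simp
    finally show ?thesis .
  qed
  thus ?thesis unfolding \<kappa>_def[symmetric]
    by (intro tendsto_sandwich[OF _ _ tendsto_const U0])
       (auto intro!: always_eventually binom_expect_nonneg p)
qed

text \<open>The parity indicator is (1 + (-1)^e (-1)^D)/2. Convergence in mean of absolute errors,
  rather than of expectations, allows the weight to be replaced by its limit in the presence of this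
  oscillating factor; the sign then only leaves a multiple of (1 - 2p)^n.\<close>

lemma tendsto_binom_expect_edge_weight_parity:
  assumes p: "0 < p" "p < 1"
  shows "(\<lambda>n. real n * binom_expect p n (\<lambda>D. edge_weight n D * of_bool (even (D
      + e)))) \<longlonglongrightarrow> 1 / (2 * sqrt (p * (1 - p)))"
proof -
  define \<kappa> where "\<kappa> = 1 / sqrt (p * (1 - p))"
  let ?err = "\<lambda>n. binom_expect p n (\<lambda>D. \<bar>real n * edge_weight n D - \<kappa>\<bar>)"
  define T where "T n = real n * binom_expect p n (\<lambda>D. edge_weight n D * of_bool (even (D + e)))" for n
  have "\<bar>T n - (\<kappa> / 2 + \<kappa> / 2 * (-1)^e * (1 - 2*p)^n)\<bar> \<le> ?err n" for n
  proof -
    have "T n - (\<kappa> / 2 + \<kappa> / 2 * (-1)^e * (1 - 2*p)^n)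
      = binom_expect p n (\<lambda>D. real n * (edge_weight n D * of_bool (even (D + e))) - (\<kappa> / 2 + \<kappa> / 2 * (-1)^e * (-1)^D))"
      by (simp only: T_def binom_expect_diff binom_expect_add binom_expect_cmult binom_expect_const binom_expect_sign)
    also have "(\<lambda>D. real n * (edge_weight n D * of_bool (even (D + e))) - (\<kappa> / 2 + \<kappa> / 2 * (-1)^e * (-1)^D))
      = (\<lambda>D. of_bool (even (D + e)) * (real n * edge_weight n D - \<kappa>))"
      by (auto simp: fun_eq_iff minus_one_power_iff)
    also have "\<bar>binom_expect p n \<dots>\<bar>
        \<le> binom_expect p n (\<lambda>D. \<bar>of_bool (even (D + e)) * (real n * edge_weight n D - \<kappa>)\<bar>)"
      by (rule binom_expect_abs_le[OF p])
    also have "\<dots> \<le> ?err n"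
      by (rule binom_expect_mono[OF p]) (auto simp: of_bool_def)
    finally show ?thesis .
  qed
  hence le: "norm (T n - (\<kappa> / 2 + \<kappa> / 2 * (-1)^e * (1 - 2*p)^n)) \<le> ?err n" for n
    unfolding real_norm_def .
  have "(\<lambda>n. T n - (\<kappa> / 2 + \<kappa> / 2 * (-1)^e * (1 - 2*p)^n)) \<longlonglongrightarrow> 0"
    by (rule Lim_null_comparison[OF always_eventually[OF allI[OF le]]])
       (rule edge_weight_L1[OF p, folded \<kappa>_def])
  moreover have "(\<lambda>n. \<kappa> / 2 + \<kappa> / 2 * (-1)^e * (1 - 2*p)^n) \<longlonglongrightarrow> \<kappa> / 2 + \<kappa> / 2 * (-1)^e * 0"
    using p by (intro tendsto_intros LIMSEQ_power_zero) auto
  ultimately have "(\<lambda>n. T n - (\<kappa> / 2 + \<kappa> / 2 * (-1)^e * (1 - 2*p)^n) + (\<kappa> / 2 + \<kappa> / 2 * (-1)^e * (1 - 2*p)^n))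
     \<longlonglongrightarrow> 0 + (\<kappa> / 2 + \<kappa> / 2 * (-1)^e * 0)" by (rule tendsto_add)
  thus ?thesis by (simp add: T_def \<kappa>_def mult.commute)
qed

section \<open>Conditional point probabilities\<close>

text \<open>The probability that a symmetric walk of k unit steps ends at s; by symmetry it depends
  only on the distance from the origin.\<close>

definition binom_off :: "nat \<Rightarrow> nat \<Rightarrow> real" where
  "binom_off k s = (if s \<le> k \<and> even (k + s) then real (k choose ((k - s) div 2)) / 2^k else 0)"

lemma binom_off_nonneg: "0 \<le> binom_off k s"
  by (simp add: binom_off_def)

lemma binom_off_le: "binom_off k s \<le> 1 / sqrt (real k + 1)"
  using binomial_half_le[of k "(k - s) div 2"] by (simp add: binom_off_def)

lemma scaled_binom_off_le_1: "sqrt (real k + 1) * binom_off k s \<le> 1"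
  using mult_left_mono[OF binom_off_le[of k s], of "sqrt (real k + 1)"] by simp

text \<open>On the wrong parity the point probability vanishes and does not approach the limit; the
  value 0 there lets the error tend to 0 along all k.\<close>

definition binom_off_error :: "nat \<Rightarrow> nat \<Rightarrow> real" where
  "binom_off_error s k = (if even (k + s) then sqrt (real k + 1) * binom_off k s - sqrt (2/pi) else 0)"

lemma binom_off_error_tendsto_0: "binom_off_error s \<longlonglongrightarrow> 0"
proof (rule LIMSEQ_I)
  fix r :: real assume "r > 0"
  from LIMSEQ_D[OF tendsto_binomial_shift[of s] this] obtain N where
    N: "\<And>k. k \<ge> N \<Longrightarrow> norm (sqrt (2*real k + real s + 1) * (real ((2*k+s) choose k) / 2^(2*k+s)) - sqrt (2/pi)) < r"
    by blast
  have "norm (binom_off_error s k - 0) < r" if k: "k \<ge> 2 * N + s" for k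
  proof (cases "even (k + s)")
    case True
    hence "even (k - s)" using k by simp
    then obtain l where "k - s = 2 * l" by blast
    hence l: "k = 2 * l + s" using k by simp
    show ?thesis using N[of l] k by (simp add: binom_off_error_def binom_off_def l)
  qed (use \<open>r > 0\<close> in \<open>simp add: binom_off_error_def\<close>)
  thus "\<exists>no. \<forall>k\<ge>no. norm (binom_off_error s k - 0) < r" by blast
qed

lemma n_binom_expect_off_le:
  assumes p: "0 < p" "p < 1" and c: "\<And>D. c D \<le> 1"
  shows "real n * binom_expect p n (\<lambda>D. binom_off D s * binom_off (n - D) t * c D) \<le> 1 / (2 * p * (1 - p))"
proof -
  have "binom_off D s * binom_off (n - D) t * c D \<le> edge_weight n D" for D
  proof -
    have "binom_off D s * binom_off (n - D) t * c D \<le> binom_off D s * binom_off (n - D) t * 1"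
      by (intro mult_left_mono c mult_nonneg_nonneg binom_off_nonneg)
    also have "\<dots> \<le> (1 / sqrt (real D + 1)) * (1 / sqrt (real (n - D) + 1)) * 1"
      by (intro mult_right_mono mult_mono binom_off_le binom_off_nonneg) auto
    finally show ?thesis by (simp add: edge_weight_def)
  qed
  hence "real n * binom_expect p n (\<lambda>D. binom_off D s * binom_off (n - D) t * c D) \<le> real n * binom_expect p n (edge_weight n)"
    by (intro mult_left_mono binom_expect_mono p) auto
  also have "\<dots> \<le> 1 / (2 * p * (1 - p))" by (rule n_binom_expect_edge_weight_le[OF p])
  finally show ?thesis .
qed

text \<open>The two point probabilities are replaced by sqrt(2/pi) over their roots and c by 1/2,
  with errors vanishing as D or n - D grows; the edge weight estimates absorb both. The shift t may
  alternate between two values because the majority threshold depends on the parity of n.\<close>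

lemma n_binom_expect_off_tendsto:
  assumes p: "0 < p" "p < 1"
    and t: "\<And>n. t n = a \<or> t n = Suc a" "\<And>n. n > 0 \<Longrightarrow> even (n + s + t n)"
    and c: "\<And>n D. n > 0 \<Longrightarrow> D \<le> n \<Longrightarrow> even (D + s) \<Longrightarrow> t n
        \<le> n - D \<Longrightarrow> \<bar>c n D - 1/2\<bar> \<le> K / sqrt (real D + 1)"
  shows "(\<lambda>n. real n * binom_expect p n (\<lambda>D. binom_off D s * binom_off (n - D) (t n) * c n D))
    \<longlonglongrightarrow> 1 / (2 * pi * sqrt (p * (1 - p)))"
proof -
  define W where "W n D = edge_weight n D * of_bool (even (D + s))" for n D
  define g where "g D = \<bar>K\<bar> / sqrt (real D + 1) + \<bar>binom_off_error s D\<bar>" for D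
  define h where "h D = \<bar>binom_off_error a D\<bar> + \<bar>binom_off_error (Suc a) D\<bar>" for D
  have g0: "g \<longlonglongrightarrow> 0"
  proof -
    have "(\<lambda>D. \<bar>K\<bar> / sqrt (real D + 1)) \<longlonglongrightarrow> 0" by real_asymp
    from tendsto_add[OF this tendsto_rabs_zero[OF binom_off_error_tendsto_0[of s]]]
    show ?thesis by (simp add: g_def[abs_def])
  qed
  have h0: "h \<longlonglongrightarrow> 0"
    using tendsto_add[OF tendsto_rabs_zero[OF binom_off_error_tendsto_0[of a]]
          tendsto_rabs_zero[OF binom_off_error_tendsto_0[of "Suc a"]]] by (simp add: h_def[abs_def])
  let ?F = "\<lambda>n D. binom_off D s * binom_off (n - D) (t n) * c n D"
  have key: "\<bar>?F n D - 1 / pi * W n D\<bar> \<le> edge_weight n D * \<bar>g D\<bar> + edge_weight n D * \<bar>h (n - D)\<bar>"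
    if n: "n > 0" and D: "D \<le> n" for n D
  proof (cases "even (D + s)")
    case False
    hence "?F n D = 0" "W n D = 0" by (auto simp: binom_off_def W_def)
    hence "\<bar>?F n D - 1 / pi * W n D\<bar> = 0" by (simp only:)
    thus ?thesis by (simp only: add_nonneg_nonneg mult_nonneg_nonneg edge_weight_nonneg abs_ge_zero)
  next
    case ev: True
    define x y z where "x = sqrt (real D + 1) * binom_off D s"
      and "y = sqrt (real (n - D) + 1) * binom_off (n - D) (t n)" and "z = sqrt (2 / pi)"
    have ev2: "even (n - D + t n)" using ev t(2)[OF n] D by (cases "even n"; cases "even s") (simp_all add: even_diff_nat)
    have ex: "x = z + binom_off_error s D" using ev by (simp add: x_def z_def binom_off_error_def)
    have ey: "y = z + binom_off_error (t n) (n - D)" using ev2 by (simp add: y_def z_def binom_off_error_def)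
    have x: "0 \<le> x" "x \<le> 1" and y: "0 \<le> y" "y \<le> 1"
      using scaled_binom_off_le_1 binom_off_nonneg by (auto simp: x_def y_def)
    have z: "0 \<le> z" "z \<le> 1" "z * z = 2 / pi" using pi_gt3 by (auto simp: z_def)
    have F: "?F n D = edge_weight n D * (x * y * c n D)"
      by (simp add: edge_weight_def x_def y_def)
    have W: "W n D = edge_weight n D" using ev by (simp add: W_def)
    have 1: "\<bar>x * y * (c n D - 1/2)\<bar> \<le> \<bar>K\<bar> / sqrt (real D + 1)"
    proof (cases "t n \<le> n - D")
      case True
      have "\<bar>x * y * (c n D - 1/2)\<bar> = x * y * \<bar>c n D - 1/2\<bar>" using x y by (simp add: abs_mult)
      also have "\<dots> \<le> 1 * 1 * \<bar>c n D - 1/2\<bar>" using x y by (intro mult_right_mono mult_mono) auto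
      also have "\<dots> \<le> K / sqrt (real D + 1)" using c[OF n D ev True] by simp
      also have "\<dots> \<le> \<bar>K\<bar> / sqrt (real D + 1)" by (intro divide_right_mono) auto
      finally show ?thesis .
    next
      \<comment> \<open>Here nothing is known about c, but the second point probability is
        0.\<close>
      case False
      hence "y = 0" by (simp add: y_def binom_off_def)
      thus ?thesis by simp
    qed
    have "x * y - z * z = (x - z) * y + z * (y - z)" by (simp add: algebra_simps)
    also have "\<bar>\<dots>\<bar> \<le> \<bar>x - z\<bar> * y + z * \<bar>y - z\<bar>"
      using y z by (intro order_trans[OF abs_triangle_ineq]) (simp add: abs_mult)
    also have "\<dots> \<le> \<bar>x - z\<bar> * 1 + 1 * \<bar>y - z\<bar>"
      using y z by (intro add_mono mult_left_mono mult_right_mono) auto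
    also have "\<dots> = \<bar>binom_off_error s D\<bar> + \<bar>binom_off_error (t n) (n - D)\<bar>" by (simp add: ex ey)
    also have "\<dots> \<le> \<bar>binom_off_error s D\<bar> + h (n - D)" using t(1)[of n] by (auto simp: h_def)
    finally have 2: "\<bar>x * y - z * z\<bar> \<le> \<bar>binom_off_error s D\<bar> + h (n - D)" .
    have "x * y * c n D - 1 / pi = x * y * (c n D - 1/2) + (x * y - z * z) / 2"
      unfolding z by (simp add: algebra_simps diff_divide_distrib)
    moreover have "\<bar>u\<bar> \<le> X + Y" if "u = v + w / 2" "\<bar>v\<bar> \<le> X" "\<bar>w\<bar> \<le> Y" for u v w X Y :: real
      using that by linarith
    ultimately have "\<bar>x * y * c n D - 1 / pi\<bar> \<le> \<bar>K\<bar> / sqrt (real D + 1) + (\<bar>binom_off_error s D\<bar> + h (n - D))"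
      using 1 2 by blast
    hence "\<bar>x * y * c n D - 1 / pi\<bar> \<le> g D + h (n - D)" by (simp only: g_def add.assoc)
    moreover have "g D \<ge> 0" "h (n - D) \<ge> 0" by (auto simp: g_def h_def)
    ultimately have "\<bar>x * y * c n D - 1 / pi\<bar> \<le> \<bar>g D\<bar> + \<bar>h (n - D)\<bar>" by simp
    hence "edge_weight n D * \<bar>x * y * c n D - 1 / pi\<bar> \<le> edge_weight n D * (\<bar>g D\<bar> + \<bar>h (n - D)\<bar>)"
      by (intro mult_left_mono edge_weight_nonneg)
    moreover have "\<bar>?F n D - 1 / pi * W n D\<bar> = edge_weight n D * \<bar>x * y * c n D - 1 / pi\<bar>"
    proof -
      have "?F n D - 1 / pi * W n D = edge_weight n D * (x * y * c n D - 1 / pi)"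
        unfolding F W by (simp add: algebra_simps)
      thus ?thesis by (simp only: abs_mult abs_of_nonneg[OF edge_weight_nonneg])
    qed
    ultimately show ?thesis by (simp only: distrib_left)
  qed
  let ?err = "\<lambda>n. real n * binom_expect p n (\<lambda>D. edge_weight n D * \<bar>g D\<bar>)
      + real n * binom_expect p n (\<lambda>D. edge_weight n D * \<bar>h (n - D)\<bar>)"
  have err0: "?err \<longlonglongrightarrow> 0"
    using tendsto_add[OF edge_weight_error_tendsto_0[OF p g0] edge_weight_error_tendsto_0_flip[OF p h0]] by simp
  have le: "norm (real n * binom_expect p n (?F n) - 1 / pi * (real n * binom_expect p n (W n))) \<le> ?err n" for n
  proof (cases "n > 0")
    case n: True
    have e: "real n * binom_expect p n (?F n) - 1 / pi * (real n * binom_expect p n (W n))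
      = real n * binom_expect p n (\<lambda>D. ?F n D - 1 / pi * W n D)"
      unfolding binom_expect_diff binom_expect_cmult by (simp add: algebra_simps)
    have "norm (real n * binom_expect p n (\<lambda>D. ?F n D - 1 / pi * W n D))
      \<le> real n * binom_expect p n (\<lambda>D. \<bar>?F n D - 1 / pi * W n D\<bar>)"
      using mult_left_mono[OF binom_expect_abs_le[OF p], of "real n" n "\<lambda>D. ?F n D - 1 / pi * W n D"] by (simp add: abs_mult)
    also have "\<dots> \<le> real n * binom_expect p n (\<lambda>D. edge_weight n D * \<bar>g D\<bar> + edge_weight n D * \<bar>h (n - D)\<bar>)"
      by (intro mult_left_mono binom_expect_mono p key n) auto
    also have "\<dots> = ?err n" by (simp only: binom_expect_add distrib_left)
    finally show ?thesis unfolding e .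
  qed simp
  have "(\<lambda>n. real n * binom_expect p n (?F n) - 1 / pi * (real n * binom_expect p n (W n))) \<longlonglongrightarrow> 0"
    by (rule Lim_null_comparison[OF always_eventually[OF allI[OF le]] err0])
  moreover have "(\<lambda>n. 1 / pi * (real n * binom_expect p n (W n))) \<longlonglongrightarrow> 1 / pi * (1 / (2 * sqrt (p * (1 - p))))"
    unfolding W_def by (intro tendsto_mult tendsto_const tendsto_binom_expect_edge_weight_parity p)
  ultimately have "(\<lambda>n. (real n * binom_expect p n (?F n) - 1 / pi * (real n * binom_expect p n (W n)))
     + 1 / pi * (real n * binom_expect p n (W n))) \<longlonglongrightarrow> 0 + 1 / pi * (1 / (2 * sqrt (p * (1 - p))))"
    by (rule tendsto_add)
  thus ?thesis by (simp add: mult.assoc mult.left_commute)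
qed

section \<open>The third coordinate\<close>

definition lower_mass :: "nat \<Rightarrow> real poly \<Rightarrow> real" where
  "lower_mass m W = (\<Sum>h\<le>m. coeff W h)"

abbreviation bernoulli_poly :: "real \<Rightarrow> real poly" where
  "bernoulli_poly t \<equiv> [:1 - t, t:]"

lemma coeff_bernoulli_mult:
  "coeff (bernoulli_poly t * W) h = (1 - t) * coeff W h + t * (if h = 0 then 0 else coeff W (h - 1))"
  by (cases h) (simp_all add: coeff_pCons)

text \<open>For a generating function of a law, \<open>lower_mass\<close> is its distribution
  function at m. One more trial with success probability t pushes exactly the fraction t of the atom
  at m beyond the threshold.\<close>

lemma lower_mass_bernoulli_mult: "lower_mass m (bernoulli_poly t * W) = lower_mass m W - t * coeff W m"
proof (induction m)
  case (Suc m)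
  thus ?case unfolding lower_mass_def
    by (simp only: sum.atMost_Suc coeff_bernoulli_mult) (simp add: algebra_simps)
qed (simp add: lower_mass_def coeff_bernoulli_mult algebra_simps)

lemma coeff_bernoulli_mult_bounds:
  assumes "0 \<le> t" "t \<le> 1" "\<And>h. 0 \<le> coeff W h" "\<And>h. coeff W h \<le> M"
  shows "0 \<le> coeff (bernoulli_poly t * W) h" "coeff (bernoulli_poly t * W) h \<le> M"
proof -
  have M: "0 \<le> M" using assms(3,4)[of 0] by linarith
  show "0 \<le> coeff (bernoulli_poly t * W) h" unfolding coeff_bernoulli_mult using assms by simp
  have "coeff (bernoulli_poly t * W) h \<le> (1 - t) * M + t * M"
    unfolding coeff_bernoulli_mult using assms M by (intro add_mono mult_left_mono) auto
  thus "coeff (bernoulli_poly t * W) h \<le> M" by (simp add: algebra_simps)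
qed

lemma coeff_bernoulli_power_mult_bounds:
  assumes "0 \<le> t" "t \<le> 1" "\<And>h. 0 \<le> coeff W h" "\<And>h. coeff W h \<le> M"
  shows "0 \<le> coeff (bernoulli_poly t ^ s * W) h \<and> coeff (bernoulli_poly t ^ s * W) h \<le> M"
proof (induction s arbitrary: h)
  case (Suc s)
  thus ?case using coeff_bernoulli_mult_bounds[OF assms(1,2), of "bernoulli_poly t ^ s * W" M]
    by (simp only: power_Suc mult.assoc)
qed (use assms in auto)

lemma lower_mass_bernoulli_power_mult:
  assumes "0 \<le> t" "t \<le> 1" "\<And>h. 0 \<le> coeff W h" "\<And>h. coeff W h \<le> M"
  shows "\<bar>lower_mass m (bernoulli_poly t ^ s * W) - lower_mass m W\<bar> \<le> real s * M"
proof (induction s)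
  case (Suc s)
  let ?c = "coeff (bernoulli_poly t ^ s * W) m"
  have c: "0 \<le> ?c" "?c \<le> M" using coeff_bernoulli_power_mult_bounds[OF assms] by auto
  have "t * ?c \<le> 1 * M" using assms c by (intro mult_mono) auto
  moreover have "0 \<le> t * ?c" using assms c by auto
  ultimately show ?case using Suc
    by (simp only: power_Suc mult.assoc lower_mass_bernoulli_mult of_nat_Suc distrib_right mult_1)
qed simp

lemma lower_mass_total:
  assumes "degree W \<le> n"
  shows "lower_mass n W = poly W 1"
proof -
  have "poly W 1 = (\<Sum>i\<le>degree W. coeff W i)" by (simp add: poly_altdef)
  also have "\<dots> = (\<Sum>i\<le>n. coeff W i)"
    using assms by (intro sum.mono_neutral_left) (auto simp: coeff_eq_0)
  finally show ?thesis by (simp add: lower_mass_def)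
qed

lemma lower_mass_reflect:
  assumes "m < degree W"
  shows "lower_mass m W + lower_mass (degree W - Suc m) (reflect_poly W) = poly W 1"
proof -
  let ?n = "degree W"
  have "lower_mass (?n - Suc m) (reflect_poly W) = (\<Sum>h\<in>{m<..?n}. coeff W h)"
    unfolding lower_mass_def
    by (rule sum.reindex_bij_witness[of _ "\<lambda>h. ?n - h" "\<lambda>h. ?n - h"])
       (use assms in \<open>auto simp: coeff_reflect_poly\<close>)
  hence "lower_mass m W + lower_mass (?n - Suc m) (reflect_poly W) = (\<Sum>h\<in>{..m} \<union> {m<..?n}. coeff W h)"
    by (subst sum.union_disjoint) (auto simp: lower_mass_def)
  also have "{..m} \<union> {m<..?n} = {..?n}" using assms by auto
  finally show ?thesis using lower_mass_total[of W ?n] by (simp add: lower_mass_def)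
qed

lemma coeff_fair_power: "coeff (bernoulli_poly (1/2) ^ D) h = real (D choose h) / 2^D"
proof (induction D arbitrary: h)
  case 0 show ?case by (cases h) (auto simp: coeff_1)
next
  case (Suc D)
  show ?case by (cases h)
    (simp_all only: power_Suc coeff_bernoulli_mult Suc.IH, simp_all add: field_simps)
qed

text \<open>The conditional law of the support for candidate 3: fair for the D voters separating 1
  and 2, success probability r for the y voters placing both above 4, and 1 - r for the w voters
  placing both below.\<close>

definition third_poly :: "real \<Rightarrow> nat \<Rightarrow> nat \<Rightarrow> nat \<Rightarrow> real poly" where
  "third_poly r D y w = bernoulli_poly (1/2)^D * bernoulli_poly r^y * bernoulli_poly (1-r)^w"

text \<open>The D fair factors alone have atoms of this size, and every further Bernoulli factor
  forms convex combinations of neighbouring atoms.\<close>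

lemma coeff_third_poly_bounds:
  assumes r: "0 < r" "r < 1"
  shows "0 \<le> coeff (third_poly r D y w) h \<and> coeff (third_poly r D y w) h \<le> 1 / sqrt (real D + 1)"
proof -
  let ?M = "1 / sqrt (real D + 1)"
  have r': "0 \<le> r" "r \<le> 1" "0 \<le> 1 - r" "1 - r \<le> 1" using r by auto
  have 1: "0 \<le> coeff (bernoulli_poly (1/2)^D) h" "coeff (bernoulli_poly (1/2)^D) h \<le> ?M" for h
    unfolding coeff_fair_power using binomial_half_le[of D h] by auto
  note 2 = coeff_bernoulli_power_mult_bounds[OF r'(1,2) 1, of y]
  note 3 = coeff_bernoulli_power_mult_bounds[OF r'(3,4) conjunct1[OF 2] conjunct2[OF 2], of w]
  show ?thesis using 3[of h] by (simp only: third_poly_def ac_simps)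
qed

lemma poly_third_poly_1: "poly (third_poly r D y w) 1 = 1"
  by (simp add: third_poly_def poly_mult poly_power)

lemma lower_mass_third_poly_bounds:
  assumes r: "0 < r" "r < 1"
  shows "0 \<le> lower_mass m (third_poly r D y w)" "lower_mass m (third_poly r D y w) \<le> 1"
proof -
  note b = conjunct1[OF coeff_third_poly_bounds[OF r]]
  show "0 \<le> lower_mass m (third_poly r D y w)" unfolding lower_mass_def by (intro sum_nonneg b)
  let ?n = "max m (degree (third_poly r D y w))"
  have "lower_mass m (third_poly r D y w) \<le> lower_mass ?n (third_poly r D y w)"
    unfolding lower_mass_def by (intro sum_mono2 b) auto
  also have "\<dots> = 1" by (simp add: lower_mass_total poly_third_poly_1)
  finally show "lower_mass m (third_poly r D y w) \<le> 1" .
qed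

lemma reflect_bernoulli_poly: "0 < t \<Longrightarrow> t < 1 \<Longrightarrow> reflect_poly (bernoulli_poly t) = bernoulli_poly (1 - t)"
  by (simp add: reflect_poly_pCons' monom_Suc monom_0)

lemma reflect_third_poly:
  assumes r: "0 < r" "r < 1"
  shows "reflect_poly (third_poly r D y w) = third_poly r D w y"
proof -
  have "reflect_poly (third_poly r D y w) = bernoulli_poly (1 - 1/2)^D * bernoulli_poly (1-r)^y * bernoulli_poly (1-(1-r))^w"
    using r by (simp only: third_poly_def reflect_poly_mult reflect_poly_power reflect_bernoulli_poly)
  thus ?thesis by (simp add: third_poly_def mult_ac)
qed

lemma degree_third_poly:
  assumes r: "0 < r" "r < 1"
  shows "degree (third_poly r D y w) = D + y + w"
proof -
  have "degree (third_poly r D y w) = degree (bernoulli_poly (1/2)^D) + degree (bernoulli_poly r^y) + degree (bernoulli_poly (1-r)^w)"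
    unfolding third_poly_def using r by (subst degree_mult_eq; simp)+
  thus ?thesis using r by (simp add: degree_power_eq)
qed

text \<open>Exchanging the two kinds of agreeing voters reverses the order of the coefficients, while
  the \<open>s\<close> voters by which the two kinds differ move the distribution function by at most \<open>s\<close>
  atoms, each of size \<open>O(D\<^sup>-\<^sup>1\<^sup>/\<^sup>2)\<close>.\<close>
lemma lower_mass_third_poly_half:
  assumes r: "0 < r" "r < 1" and n: "D + 2*y + s = 2*m + e" "e = 1 \<or> e = 2"
  shows "\<bar>lower_mass m (third_poly r D y (y + s)) - 1/2\<bar> \<le> (real s + 1) / sqrt (real D + 1)"
proof -
  define M where "M = 1 / sqrt (real D + 1)"
  let ?U = "third_poly r D y y" and ?W = "third_poly r D y (y + s)" and ?V = "third_poly r D (y + s) y"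
  have b: "0 \<le> coeff (third_poly r D y' w) h" "coeff (third_poly r D y' w) h \<le> M" for y' w h
    using coeff_third_poly_bounds[OF r] by (auto simp: M_def)
  have W: "?W = bernoulli_poly (1-r)^s * ?U" by (simp only: third_poly_def power_add mult_ac)
  have V: "?V = bernoulli_poly r^s * ?U" by (simp only: third_poly_def power_add mult_ac)
  have 1: "\<bar>lower_mass m ?W - lower_mass m ?U\<bar> \<le> real s * M"
    unfolding W using r by (intro lower_mass_bernoulli_power_mult b) auto
  have 2: "\<bar>lower_mass m ?V - lower_mass m ?U\<bar> \<le> real s * M"
    unfolding V using r by (intro lower_mass_bernoulli_power_mult b) auto
  have deg: "degree ?W = 2*m + e" using n by (simp add: degree_third_poly[OF r])
  have 3: "lower_mass m ?W + lower_mass (2*m + e - Suc m) ?V = 1"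
    using lower_mass_reflect[of m ?W] n deg by (auto simp: reflect_third_poly[OF r] poly_third_poly_1)
  \<comment> \<open>Reversal sends the threshold m to m + e - 1. For e = 2 this adds the atom at m +
    1, which accounts for the 1 in \<open>real s + 1\<close>.\<close>
  have 4: "\<bar>lower_mass (2*m + e - Suc m) ?V - lower_mass m ?V\<bar> \<le> M"
  proof -
    have M0: "M \<ge> 0" by (simp add: M_def)
    show ?thesis using n(2)
    proof
      assume "e = 1" thus ?thesis using M0 by simp
    next
      assume "e = 2"
      hence "2*m + e - Suc m = Suc m" by simp
      thus ?thesis using b[of "y+s" y "Suc m"] by (simp add: lower_mass_def)
    qed
  qed
  have M0: "0 \<le> M" by (simp add: M_def)
  have "\<bar>w - 1/2\<bar> \<le> k + M"
    if "\<bar>w - u\<bar> \<le> k" "\<bar>v - u\<bar> \<le> k" "w + v' = 1" "\<bar>v' - v\<bar> \<le> M" for w u v v' k :: real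
    using that M0 by linarith
  from this[OF 1 2 3 4] have "\<bar>lower_mass m ?W - 1/2\<bar> \<le> real s * M + M" .
  thus ?thesis by (simp add: M_def add_divide_distrib)
qed

section \<open>The tilted local limit\<close>

definition mono2 :: "real poly \<Rightarrow> nat \<Rightarrow> nat \<Rightarrow> real poly poly poly" where
  "mono2 c a b = monom (monom c b) a"

lemma mono2_mult: "mono2 c a b * mono2 c' a' b' = mono2 (c * c') (a + a') (b + b')"
  by (simp add: mono2_def mult_monom)

lemma mono2_power: "mono2 c a b ^ k = mono2 (c ^ k) (a * k) (b * k)"
  by (simp add: mono2_def monom_power)

lemma of_nat_mult_mono2: "of_nat k * mono2 c a b = mono2 (of_nat k * c) a b"
proof -
  have "of_nat k = mono2 (of_nat k) 0 0" by (simp add: mono2_def monom_0 of_nat_poly)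
  thus ?thesis by (simp add: mono2_mult)
qed

lemma coeff_mono2: "coeff (coeff (mono2 c a b) i) j = (if a = i \<and> b = j then c else 0)"
  by (simp add: mono2_def coeff_monom)

text \<open>The outer two variables record support for candidates 1 and 2 against candidate 4, the
  innermost one records support for candidate 3; \<open>p\<close> is the probability that a voter ranks exactly
  one of 1 and 2 above 4, and \<open>r\<close> that candidate 3 sides with 1 and 2 when these agree.\<close>
definition voter_poly :: "real \<Rightarrow> real \<Rightarrow> real poly poly poly" where
  "voter_poly p r = mono2 (Polynomial.smult (p/2) (bernoulli_poly (1/2))) 1 0 + mono2 (Polynomial.smult (p/2) (bernoulli_poly (1/2))) 0 1
    + (mono2 (Polynomial.smult ((1-p)/2) (bernoulli_poly r)) 1 1 + mono2 (Polynomial.smult ((1-p)/2) (bernoulli_poly (1-r))) 0 0)"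

lemma cmult_sum_product:
  fixes c :: "'a :: comm_semiring_1"
  shows "c * sum f A * sum g B = (\<Sum>x\<in>A. \<Sum>y\<in>B. c * f x * g y)"
  unfolding mult.assoc sum_product by (simp only: sum_distrib_left)

text \<open>Two-stage binomial expansion: D voters separate 1 and 2, of whom x favour candidate 1;
  of the n - D others, y place both above 4. This makes N_1 = x + y and N_2 = D - x + y.\<close>

lemma voter_poly_power:
  "voter_poly p r ^ n = (\<Sum>D\<le>n. \<Sum>x\<le>D. \<Sum>y\<le>n-D.
     mono2 (Polynomial.smult (binom_mass p n D * (real (D choose x) / 2^D) * (real ((n-D) choose y) / 2^(n-D)))
       (third_poly r D y (n-D-y))) (x+y) (D-x+y))"
proof -
  let ?c = "Polynomial.smult (p/2) (bernoulli_poly (1/2))"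
  let ?u = "Polynomial.smult ((1-p)/2) (bernoulli_poly r)" and ?v = "Polynomial.smult ((1-p)/2) (bernoulli_poly (1-r))"
  have "voter_poly p r ^ n = (\<Sum>D\<le>n. of_nat (n choose D)
      * (\<Sum>x\<le>D. of_nat (D choose x) * mono2 ?c 1 0 ^ x * mono2 ?c 0 1 ^ (D - x))
      * (\<Sum>y\<le>n-D. of_nat ((n-D) choose y) * mono2 ?u 1 1 ^ y * mono2 ?v 0 0 ^ (n-D-y)))"
    by (simp only: voter_poly_def binomial_ring)
  also have "\<dots> = (\<Sum>D\<le>n. \<Sum>x\<le>D. \<Sum>y\<le>n-D. of_nat (n choose D)
      * (of_nat (D choose x) * mono2 ?c 1 0 ^ x * mono2 ?c 0 1 ^ (D - x))
      * (of_nat ((n-D) choose y) * mono2 ?u 1 1 ^ y * mono2 ?v 0 0 ^ (n-D-y)))"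
    by (intro sum.cong refl cmult_sum_product)
  also have "\<dots> = (\<Sum>D\<le>n. \<Sum>x\<le>D. \<Sum>y\<le>n-D.
     mono2 (Polynomial.smult (binom_mass p n D * (real (D choose x) / 2^D) * (real ((n-D) choose y) / 2^(n-D)))
       (third_poly r D y (n-D-y))) (x+y) (D-x+y))"
  proof (intro sum.cong refl)
    fix D x y assume D: "D \<in> {..n}" and x: "x \<in> {..D}" and y: "y \<in> {..n-D}"
    have "of_nat (n choose D) * (of_nat (D choose x) * mono2 ?c 1 0 ^ x * mono2 ?c 0 1 ^ (D - x))
      * (of_nat ((n-D) choose y) * mono2 ?u 1 1 ^ y * mono2 ?v 0 0 ^ (n-D-y))
      = mono2 (of_nat (n choose D) * (of_nat (D choose x) * (?c ^ x * ?c ^ (D - x)))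
          * (of_nat ((n-D) choose y) * (?u ^ y * ?v ^ (n-D-y)))) (x+y) (D-x+y)"
      by (simp only: mono2_power mono2_mult of_nat_mult_mono2 mult.assoc mult_1 mult_0 mult_1_left add_0 add_0_right add.commute add.left_commute)
    also have "of_nat (n choose D) * (of_nat (D choose x) * (?c ^ x * ?c ^ (D - x)))
          * (of_nat ((n-D) choose y) * (?u ^ y * ?v ^ (n-D-y)))
      = Polynomial.smult (real (n choose D) * real (D choose x) * real ((n-D) choose y) * (p/2)^D * ((1-p)/2)^(n-D)) (third_poly r D y (n-D-y))"
    proof -
      have 1: "?c ^ x * ?c ^ (D - x) = Polynomial.smult ((p/2)^D) (bernoulli_poly (1/2) ^ D)"
      proof -
        have "?c ^ x * ?c ^ (D - x) = ?c ^ (x + (D - x))" by (rule power_add[symmetric])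
        also have "x + (D - x) = D" using x by simp
        finally show ?thesis by (simp only: smult_power)
      qed
      have 2: "?u ^ y * ?v ^ (n-D-y) = Polynomial.smult (((1-p)/2)^(n-D)) (bernoulli_poly r ^ y * bernoulli_poly (1-r) ^ (n-D-y))"
      proof -
        have "((1-p)/2)^y * ((1-p)/2)^(n-D-y) = ((1-p)/2)^(n-D)"
        proof -
          have e: "y + (n - D - y) = n - D" using y by simp
          show ?thesis by (simp only: power_add[symmetric] e)
        qed
        thus ?thesis by (simp only: smult_power mult_smult_left mult_smult_right smult_smult mult.commute)
      qed
      have 3: "of_nat k * P = Polynomial.smult (real k) P" for k and P :: "real poly"
        by (simp add: of_nat_poly)
      show ?thesis
        by (simp only: 1 2 3 mult_smult_left mult_smult_right smult_smult third_poly_def) (simp only: mult_ac)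
    qed
    also have "real (n choose D) * real (D choose x) * real ((n-D) choose y) * (p/2)^D * ((1-p)/2)^(n-D)
      = binom_mass p n D * (real (D choose x) / 2^D) * (real ((n-D) choose y) / 2^(n-D))"
      by (simp add: binom_mass_def power_divide)
    finally show "of_nat (n choose D) * (of_nat (D choose x) * mono2 ?c 1 0 ^ x * mono2 ?c 0 1 ^ (D - x))
      * (of_nat ((n-D) choose y) * mono2 ?u 1 1 ^ y * mono2 ?v 0 0 ^ (n-D-y))
      = mono2 (Polynomial.smult (binom_mass p n D * (real (D choose x) / 2^D) * (real ((n-D) choose y) / 2^(n-D)))
       (third_poly r D y (n-D-y))) (x+y) (D-x+y)" .
  qed
  finally show ?thesis .
qed

definition absdiff :: "nat \<Rightarrow> nat \<Rightarrow> nat" where "absdiff i j = (i - j) + (j - i)"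

text \<open>The constraints are equivalent to 2x = D + j - i and 2y = n - D - (e + i + j), so at
  most one pair survives. Separating voters thus carry the difference of the two counts and agreeing
  voters their sum, which is why two independent walks appear.\<close>

lemma sum_constrained_pairs:
  fixes f :: "nat \<Rightarrow> real"
  assumes n: "n = 2*m + e" and ij: "i \<le> m" "j \<le> m" and D: "D \<le> n" and e: "e = 1 \<or> e = 2"
  shows "(\<Sum>x\<le>D. \<Sum>y\<le>n-D. if x + y = m - i \<and> D - x + y = m - j
      then (real (D choose x) / 2^D) * (real ((n-D) choose y) / 2^(n-D)) * f y else 0)
    = binom_off D (absdiff i j) * binom_off (n - D) (e + i + j) * f ((n - D - (e + i + j)) div 2)"
    (is "?lhs = ?rhs")
proof -
  define t where "t = e + i + j"
  let ?g = "\<lambda>(x,y). (real (D choose x) / 2^D) * (real ((n-D) choose y) / 2^(n-D)) * f y"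
  define S where "S = {(x,y). x \<le> D \<and> y \<le> n - D \<and> x + y = m - i \<and> D - x + y = m - j}"
  have "?lhs = (\<Sum>z\<in>{..D}\<times>{..n-D}. if z \<in> S then ?g z else 0)"
    by (simp only: sum.cartesian_product) (auto intro!: sum.cong simp: S_def)
  also have "\<dots> = sum ?g S"
    by (subst sum.inter_restrict[symmetric]) (auto intro!: sum.cong simp: S_def)
  finally have lhs: "?lhs = sum ?g S" .
  have S_D: "x \<le> D \<and> D + j = 2 * x + i \<and> n = D + t + 2 * y" if "(x, y) \<in> S" for x y
  proof -
    have xy: "x \<le> D" "y \<le> n - D" "x + y = m - i" "D - x + y = m - j" using that by (auto simp: S_def)
    have "D + j = 2 * x + i" using xy ij by linarith
    moreover have "n = D + t + 2 * y" unfolding t_def using xy ij n by linarith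
    ultimately show ?thesis using xy(1) by blast
  qed
  show ?thesis
  proof (cases "even (D + absdiff i j) \<and> absdiff i j \<le> D \<and> t \<le> n - D")
    case True
    define y0 where "y0 = (n - D - t) div 2"
    \<comment> \<open>As n = 2m + e and t = e + i + j, the sum n + t has the parity of i - j, so the
      parity condition on D forces the one on n - D.\<close>
    have par: "even (n - D - t)"
    proof -
      have "even (n + t + absdiff i j)" unfolding n t_def absdiff_def by (cases "i \<le> j") auto
      thus ?thesis using True D by (auto simp: even_diff_nat)
    qed
    hence y0: "n - D - t = 2 * y0" by (simp add: y0_def)
    hence y0': "n = D + t + 2 * y0" using True D by linarith
    obtain x0 where x0: "D + j = 2 * x0 + i" "x0 \<le> D"
    proof (cases "i \<le> j")
      case le: True
      from True obtain k where k: "D + absdiff i j = 2 * k" by blast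
      have d: "absdiff i j = j - i" using le by (simp add: absdiff_def)
      have "D + j = 2 * k + i" using k le unfolding d by linarith
      moreover have "k \<le> D" using k True by linarith
      ultimately show ?thesis by (rule that)
    next
      case le: False
      from True obtain k where k: "D + absdiff i j = 2 * k" by blast
      have d: "absdiff i j = i - j" using le by (simp add: absdiff_def)
      have "i - j \<le> k" using k True unfolding d by linarith
      hence "D + j = 2 * (k - (i - j)) + i" using k le unfolding d by linarith
      moreover have "k - (i - j) \<le> D" using k True by linarith
      ultimately show ?thesis by (rule that)
    qed
    have S: "S = {(x0, y0)}"
    proof (intro equalityI subsetI)
      fix z assume "z \<in> S"
      moreover obtain x y where z: "z = (x, y)" by (cases z)
      ultimately have "D + j = 2 * x + i" "n = D + t + 2 * y" using S_D by blast+
      hence "x = x0" "y = y0" using x0 y0' by linarith+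
      thus "z \<in> {(x0, y0)}" by (simp add: z)
    next
      fix z assume "z \<in> {(x0, y0)}"
      moreover have "y0 \<le> n - D" using y0' by linarith
      moreover have "x0 + y0 = m - i" "D - x0 + y0 = m - j" using x0 y0' n ij unfolding t_def by linarith+
      ultimately show "z \<in> S" using x0(2) by (simp add: S_def)
    qed
    have "D choose x0 = D choose ((D - absdiff i j) div 2)"
    proof (cases "i \<le> j")
      case True
      hence "(D - absdiff i j) div 2 = D - x0" using x0 by (simp add: absdiff_def)
      thus ?thesis using binomial_symmetric[OF x0(2)] by simp
    next
      case False
      hence "(D - absdiff i j) div 2 = x0" using x0 by (simp add: absdiff_def)
      thus ?thesis by simp
    qed
    moreover have "even (n - D + t)"
    proof -
      have "n - D + t = 2 * (t + y0)" using y0' by simp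
      thus ?thesis by simp
    qed
    ultimately show ?thesis unfolding lhs S using True
      by (simp add: binom_off_def t_def[symmetric] y0_def)
  next
    case False
    have "S = {}"
    proof (rule ccontr)
      assume "S \<noteq> {}"
      then obtain x y where "(x, y) \<in> S" by auto
      hence xy: "x \<le> D" and 1: "D + j = 2 * x + i" and 2: "n = D + t + 2 * y" using S_D by blast+
      have "even (D + absdiff i j) \<and> absdiff i j \<le> D"
      proof (cases "i \<le> j")
        case True
        hence "D + absdiff i j = 2 * x" using 1 by (simp add: absdiff_def)
        moreover have "absdiff i j \<le> D" using 1 True xy by (simp add: absdiff_def)
        ultimately show ?thesis by simp
      next
        case False
        hence "D + absdiff i j = 2 * (x + (i - j))" using 1 by (simp add: absdiff_def)
        moreover have "absdiff i j \<le> D" using 1 False by (simp add: absdiff_def)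
        ultimately show ?thesis by simp
      qed
      thus False using False 2 by simp
    qed
    moreover have "even (n - D + t) \<Longrightarrow> t \<le> n - D \<Longrightarrow> even (D + absdiff i j)"
    proof -
      assume a: "even (n - D + t)" "t \<le> n - D"
      have "even (n + t + absdiff i j)" unfolding n t_def absdiff_def by (cases "i \<le> j") auto
      thus ?thesis using a D by (auto simp: even_diff_nat)
    qed
    ultimately have "binom_off D (absdiff i j) = 0 \<or> binom_off (n - D) t = 0" "S = {}"
      using False by (auto simp: binom_off_def)
    thus ?thesis unfolding lhs by (auto simp: t_def)
  qed
qed

text \<open>Undoing the tilt costs q^(-2 N_1 - N_2). Measured from the threshold m this becomes a
  summable geometric weight, with q^(-3m) as a common factor outside.\<close>

definition weighted_lower_mass :: "real \<Rightarrow> nat \<Rightarrow> real poly poly poly \<Rightarrow> real" where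
  "weighted_lower_mass q m P = (\<Sum>a\<le>m. \<Sum>b\<le>m. q^(2*(m-a) + (m-b)) * lower_mass m (coeff (coeff P a) b))"

lemma lower_mass_0 [simp]: "lower_mass m 0 = 0"
  by (simp add: lower_mass_def)

lemma lower_mass_sum: "lower_mass m (\<Sum>x\<in>A. f x) = (\<Sum>x\<in>A. lower_mass m (f x))"
  unfolding lower_mass_def coeff_sum by (rule sum.swap)

lemma lower_mass_smult: "lower_mass m (Polynomial.smult c P) = c * lower_mass m P"
  by (simp add: lower_mass_def sum_distrib_left)

definition pair_mass :: "real \<Rightarrow> real \<Rightarrow> nat \<Rightarrow> nat \<Rightarrow> nat \<Rightarrow> nat \<Rightarrow> real" where
  "pair_mass p r m n i j = lower_mass m (coeff (coeff (voter_poly p r ^ n) (m - i)) (m - j))"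

text \<open>The value (n - D - t) div 2 is the y forced by the two constraints. The remaining
  agreeing voters number y + t, so the two kinds differ by a bounded amount.\<close>

definition third_mass :: "real \<Rightarrow> nat \<Rightarrow> nat \<Rightarrow> nat \<Rightarrow> nat \<Rightarrow> real" where
  "third_mass r m n t D = lower_mass m (third_poly r D ((n - D - t) div 2) (n - D - (n - D - t) div 2))"

lemma pair_mass_eq:
  assumes n: "n = 2*m + e" "e = 1 \<or> e = 2" and ij: "i \<le> m" "j \<le> m"
  shows "pair_mass p r m n i j
    = binom_expect p n (\<lambda>D. binom_off D (absdiff i j) * binom_off (n - D) (e + i + j) * third_mass r m n (e + i + j) D)"
proof -
  have "pair_mass p r m n i j = (\<Sum>D\<le>n. \<Sum>x\<le>D. \<Sum>y\<le>n-D.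
      if x + y = m - i \<and> D - x + y = m - j then
       binom_mass p n D * (real (D choose x) / 2^D) * (real ((n-D) choose y) / 2^(n-D))
        * lower_mass m (third_poly r D y (n-D-y)) else 0)"
    unfolding pair_mass_def voter_poly_power coeff_sum lower_mass_sum coeff_mono2
    by (intro sum.cong refl) (simp add: lower_mass_smult)
  also have "\<dots> = (\<Sum>D\<le>n. binom_mass p n D * (\<Sum>x\<le>D. \<Sum>y\<le>n-D.
      if x + y = m - i \<and> D - x + y = m - j then
       (real (D choose x) / 2^D) * (real ((n-D) choose y) / 2^(n-D))
        * lower_mass m (third_poly r D y (n-D-y)) else 0))"
    unfolding sum_distrib_left by (intro sum.cong refl) simp
  also have "\<dots> = binom_expect p n (\<lambda>D. binom_off D (absdiff i j) * binom_off (n - D) (e + i + j) * third_mass r m n (e + i + j) D)"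
    unfolding binom_expect_def third_mass_def
    by (intro sum.cong refl) (simp only: atMost_iff sum_constrained_pairs[OF n(1) ij _ n(2)])
  finally show ?thesis .
qed

lemma third_mass_bounds:
  assumes "0 < r" "r < 1"
  shows "0 \<le> third_mass r m n t D" "third_mass r m n t D \<le> 1"
  unfolding third_mass_def by (rule lower_mass_third_poly_bounds[OF assms])+

lemma third_mass_half:
  assumes r: "0 < r" "r < 1" and n: "n = 2*m + e" "e = 1 \<or> e = 2"
    and D: "D \<le> n" "even (D + absdiff i j)" "e + i + j \<le> n - D"
  shows "\<bar>third_mass r m n (e + i + j) D - 1/2\<bar> \<le> (real (e + i + j) + 1) / sqrt (real D + 1)"
proof -
  have "even (n + (e + i + j) + absdiff i j)" unfolding n absdiff_def by (cases "i \<le> j") auto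
  hence "even (n - D - (e + i + j))" using D by (auto simp: even_diff_nat)
  then obtain y where y: "n - D - (e + i + j) = 2 * y" by blast
  hence e: "(n - D - (e + i + j)) div 2 = y" "n - D - y = y + (e + i + j)" using D by auto
  have "D + 2 * y + (e + i + j) = 2 * m + e" using y D n by linarith
  from lower_mass_third_poly_half[OF r this n(2)] show ?thesis unfolding third_mass_def e .
qed

text \<open>Uniformity in i and j supplies the dominating series for Tannery's theorem; the error
  bounds behind the pointwise limit grow with i + j.\<close>

lemma pair_mass_bounds:
  assumes p: "0 < p" "p < 1" and r: "0 < r" "r < 1" and n: "n = 2*m + e" "e = 1 \<or> e = 2" and ij: "i \<le> m" "j \<le> m"
  shows "0 \<le> pair_mass p r m n i j" "real n * pair_mass p r m n i j \<le> 1 / (2 * p * (1 - p))"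
  unfolding pair_mass_eq[OF n ij]
  by (intro binom_expect_nonneg p mult_nonneg_nonneg binom_off_nonneg third_mass_bounds r,
      intro n_binom_expect_off_le p third_mass_bounds r)

lemma pair_mass_tendsto:
  assumes p: "0 < p" "p < 1" and r: "0 < r" "r < 1"
  shows "(\<lambda>n. real n * pair_mass p r ((n - 1) div 2) n i j) \<longlonglongrightarrow> 1 / (2 * pi * sqrt (p * (1 - p)))"
proof -
  define e :: "nat \<Rightarrow> nat" where "e n = (if even n then 2 else 1)" for n
  have e: "n = 2 * ((n - 1) div 2) + e n" "e n = 1 \<or> e n = 2" if "n > 0" for n
    using that by (auto simp: e_def elim!: evenE oddE)
  have "(\<lambda>n. real n * binom_expect p n (\<lambda>D. binom_off D (absdiff i j) * binom_off (n - D) (e n + i + j)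
      * third_mass r ((n - 1) div 2) n (e n + i + j) D)) \<longlonglongrightarrow> 1 / (2 * pi * sqrt (p * (1 - p)))"
  \<comment> \<open>The excess e of n over 2m is 1 or 2, so the shift e + i + j takes two
    consecutive values, and i + j + 3 is the largest value of e + i + j + 1.\<close>
  proof (rule n_binom_expect_off_tendsto[OF p, where a = "i + j + 1" and K = "real (i + j + 3)"])
    show "e n + i + j = i + j + 1 \<or> e n + i + j = Suc (i + j + 1)" for n by (auto simp: e_def)
    show "even (n + absdiff i j + (e n + i + j))" for n
      by (cases "i \<le> j") (auto simp: e_def absdiff_def)
    fix n D assume n: "n > 0" and D: "D \<le> n" "even (D + absdiff i j)" "e n + i + j \<le> n - D"
    have "\<bar>third_mass r ((n - 1) div 2) n (e n + i + j) D - 1/2\<bar> \<le> (real (e n + i + j) + 1) / sqrt (real D + 1)"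
      by (rule third_mass_half[OF r e[OF n] D])
    also have "\<dots> \<le> real (i + j + 3) / sqrt (real D + 1)"
      using e(2)[OF n] by (intro divide_right_mono) auto
    finally show "\<bar>third_mass r ((n - 1) div 2) n (e n + i + j) D - 1/2\<bar> \<le> real (i + j + 3) / sqrt (real D + 1)" .
  qed
  moreover have "\<forall>\<^sub>F n in sequentially. real n * binom_expect p n (\<lambda>D. binom_off D (absdiff i j)
      * binom_off (n - D) (e n + i + j)
      * third_mass r ((n - 1) div 2) n (e n + i + j) D) = real n * pair_mass p r ((n - 1) div 2) n i j"
    using eventually_gt_at_top[of "2 * (i + j) + 2"]
  proof eventually_elim
    case (elim n)
    hence "n > 0" "i \<le> (n - 1) div 2" "j \<le> (n - 1) div 2" by auto
    thus ?case by (simp only: pair_mass_eq[OF e])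
  qed
  ultimately show ?thesis by (rule Lim_transform_eventually)
qed

text \<open>Tannery's theorem is applied to the sum over j for each fixed i and then to the sum over
  i. The bound is available only inside the truncation, so the terms are extended by 0 to full
  series.\<close>

lemma double_tannery:
  fixes f :: "nat \<Rightarrow> nat \<Rightarrow> nat \<Rightarrow> real" and m :: "nat \<Rightarrow> nat"
  assumes lim: "\<And>i j. (\<lambda>n. f n i j) \<longlonglongrightarrow> L"
    and bound: "\<And>n i j. i \<le> m n \<Longrightarrow> j \<le> m n \<Longrightarrow> \<bar>f n i j\<bar> \<le> C"
    and m: "filterlim m at_top sequentially"
    and uv: "0 \<le> u" "u < 1" "0 \<le> v" "v < 1"
  shows "(\<lambda>n. \<Sum>i\<le>m n. \<Sum>j\<le>m n. u^i * v^j * f n i j) \<longlonglongrightarrow> L / ((1 - u) * (1 - v))"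
proof -
  have C: "0 \<le> C" using bound[of 0 0 0] by linarith
  define g where "g n i j = (if i \<le> m n \<and> j \<le> m n then u^i * v^j * f n i j else 0)" for n i j
  have gle: "\<bar>g n i j\<bar> \<le> C * u^i * v^j" for n i j
  proof (cases "i \<le> m n \<and> j \<le> m n")
    case True
    have "\<bar>u^i * v^j * f n i j\<bar> = u^i * v^j * \<bar>f n i j\<bar>" using uv by (simp add: abs_mult)
    also have "\<dots> \<le> u^i * v^j * C" using uv True by (intro mult_left_mono bound) auto
    finally show ?thesis using True by (simp add: g_def mult_ac)
  qed (use C uv in \<open>auto simp: g_def\<close>)
  have glim: "(\<lambda>n. g n i j) \<longlonglongrightarrow> u^i * v^j * L" for i j
  proof -
    have ev: "\<forall>\<^sub>F n in sequentially. i + j \<le> m n" using m by (simp add: filterlim_at_top)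
    have "(\<lambda>n. u^i * v^j * f n i j) \<longlonglongrightarrow> u^i * v^j * L" by (intro tendsto_intros lim)
    moreover have "\<forall>\<^sub>F n in sequentially. u^i * v^j * f n i j = g n i j"
      using ev by eventually_elim (auto simp: g_def)
    ultimately show ?thesis by (rule Lim_transform_eventually)
  qed
  have sv: "summable (\<lambda>j. C * u^i * v^j)" for i using uv by (intro summable_mult summable_geometric) simp
  have su: "summable (\<lambda>i. C / (1 - v) * u^i)" using uv by (intro summable_mult summable_geometric) simp
  have geo: "(\<Sum>j. c * v^j) = c / (1 - v)" "(\<Sum>j. c * u^j) = c / (1 - u)" for c
    using uv by (simp_all add: suminf_mult summable_geometric suminf_geometric)
  have inner: "(\<lambda>n. \<Sum>j. g n i j) \<longlonglongrightarrow> u^i * L / (1 - v)" for i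
  proof -
    have "(\<lambda>n. \<Sum>j. g n i j) \<longlonglongrightarrow> (\<Sum>j. u^i * v^j * L)"
      by (rule conjunct2[OF conjunct2[OF tannerys_theorem[where M = "\<lambda>j. C * u^i * v^j"]]])
         (simp_all only: glim sv real_norm_def gle case_prod_unfold eventually_True trivial_limit_sequentially not_False_eq_True)
    also have "(\<Sum>j. u^i * v^j * L) = u^i * L / (1 - v)" using geo(1)[of "u^i * L"] by (simp add: mult_ac)
    finally show ?thesis .
  qed
  have le: "norm (\<Sum>j. g n i j) \<le> C / (1 - v) * u^i" for n i
  proof -
    have "norm (\<Sum>j. g n i j) \<le> (\<Sum>j. C * u^i * v^j)"
      by (rule norm_suminf_le[OF _ sv]) (simp only: real_norm_def gle)
    thus ?thesis by (simp add: geo(1))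
  qed
  have "(\<lambda>n. \<Sum>i. \<Sum>j. g n i j) \<longlonglongrightarrow> (\<Sum>i. u^i * L / (1 - v))"
    by (rule conjunct2[OF conjunct2[OF tannerys_theorem[where M = "\<lambda>i. C / (1 - v) * u^i"]]])
       (simp_all only: inner su le case_prod_unfold eventually_True trivial_limit_sequentially not_False_eq_True)
  also have "(\<Sum>i. u^i * L / (1 - v)) = L / ((1 - u) * (1 - v))"
    using geo(2)[of "L / (1 - v)"] by (simp add: mult_ac)
  also have "(\<lambda>n. \<Sum>i. \<Sum>j. g n i j) = (\<lambda>n. \<Sum>i\<le>m n. \<Sum>j\<le>m n. u^i * v^j * f n i j)"
  proof
    fix n
    have "(\<Sum>i. \<Sum>j. g n i j) = (\<Sum>i\<le>m n. \<Sum>j. g n i j)"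
      by (rule suminf_finite) (auto simp: g_def)
    also have "\<dots> = (\<Sum>i\<le>m n. \<Sum>j\<le>m n. g n i j)"
      by (intro sum.cong refl suminf_finite) (auto simp: g_def)
    also have "\<dots> = (\<Sum>i\<le>m n. \<Sum>j\<le>m n. u^i * v^j * f n i j)"
      by (intro sum.cong refl) (auto simp: g_def)
    finally show "(\<Sum>i. \<Sum>j. g n i j) = (\<Sum>i\<le>m n. \<Sum>j\<le>m n. u^i * v^j * f n i j)" .
  qed
  finally show ?thesis .
qed

lemma weighted_lower_mass_tendsto:
  assumes p: "0 < p" "p < 1" and r: "0 < r" "r < 1" and q: "0 \<le> q" "q < 1"
  shows "(\<lambda>n. real n * weighted_lower_mass q ((n - 1) div 2) (voter_poly p r ^ n))
    \<longlonglongrightarrow> 1 / (2 * pi * sqrt (p * (1 - p))) / ((1 - q^2) * (1 - q))"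
proof -
  let ?m = "\<lambda>n::nat. (n - 1) div 2"
  have "(\<lambda>n. \<Sum>i\<le>?m n. \<Sum>j\<le>?m n. (q^2)^i * q^j * (real n * pair_mass p r (?m n) n i j))
    \<longlonglongrightarrow> 1 / (2 * pi * sqrt (p * (1 - p))) / ((1 - q^2) * (1 - q))"
  proof (rule double_tannery[OF pair_mass_tendsto[OF p r]])
    show "filterlim ?m at_top sequentially"
      unfolding filterlim_at_top
    proof
      fix Z show "\<forall>\<^sub>F n in sequentially. Z \<le> ?m n"
        using eventually_ge_at_top[of "2 * Z + 1"] by eventually_elim auto
    qed
    fix n i j assume ij: "i \<le> ?m n" "j \<le> ?m n"
    show "\<bar>real n * pair_mass p r (?m n) n i j\<bar> \<le> 1 / (2 * p * (1 - p))"
    proof (cases "n = 0")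
      case False
      have n: "n = 2 * ?m n + (if even n then 2 else 1)" "(if even n then 2 else 1) = 1 \<or> (if even n then 2 else 1) = (2::nat)"
        using False by (auto elim!: evenE oddE)
      show ?thesis using pair_mass_bounds[OF p r n ij] by simp
    qed (use p in auto)
  qed (use q in \<open>auto simp: power_less_one_iff\<close>)
  moreover have "(\<Sum>i\<le>m. \<Sum>j\<le>m. (q^2)^i * q^j * (real n * pair_mass p r m n i j))
     = real n * weighted_lower_mass q m (voter_poly p r ^ n)" for m n
  proof -
    have flip: "(\<Sum>a\<le>m. h a) = (\<Sum>i\<le>m. h (m - i))" for h :: "nat \<Rightarrow> real"
      by (rule sum.reindex_bij_witness[of _ "\<lambda>i. m - i" "\<lambda>i. m - i"]) auto
    have "weighted_lower_mass q m (voter_poly p r ^ n)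
      = (\<Sum>i\<le>m. \<Sum>j\<le>m. q^(2*(m-(m-i)) + (m-(m-j))) * pair_mass p r m n i j)"
      unfolding weighted_lower_mass_def pair_mass_def by (subst flip, subst (2) flip) rule
    also have "\<dots> = (\<Sum>i\<le>m. \<Sum>j\<le>m. (q^2)^i * q^j * pair_mass p r m n i j)"
      by (intro sum.cong refl) (simp add: power_add power_mult)
    finally show ?thesis by (simp add: sum_distrib_left mult_ac)
  qed
  ultimately show ?thesis by simp
qed

section \<open>Explicit weights of the Mallows culture\<close>

lemma less_less_four_iff:
  fixes i k :: nat
  shows "i < k \<and> k < 4 \<longleftrightarrow> (i,k) \<in> {(0,1),(0,2),(0,3),(1,2),(1,3),(2,3)}"
  by simp presburger

lemma above_four:
  "above [w,x,y,z] a b \<longleftrightarrow> w = a \<and> x = b \<or> w = a \<and> y = b \<or> w = a \<and> z = b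
    \<or> x = a \<and> y = b \<or> x = a \<and> z = b \<or> y = a \<and> z = b"
proof -
  let ?r = "[w,x,y,z]"
  have "above ?r a b \<longleftrightarrow> (\<exists>z\<in>{(0,1),(0,2),(0,3),(1,2),(1,3),(2,3)}. ?r ! fst z = a \<and> ?r ! snd z = b)"
    (is "_ \<longleftrightarrow> ?E")
  proof -
    have "above ?r a b \<longleftrightarrow> (\<exists>i k. (i < k \<and> k < 4) \<and> ?r ! i = a \<and> ?r ! k = b)"
      by (simp add: above_def eval_nat_numeral conj_assoc)
    also have "\<dots> \<longleftrightarrow> ?E" unfolding less_less_four_iff by (simp only: Bex_def split_paired_Ex fst_conv snd_conv)
    finally show ?thesis .
  qed
  thus ?thesis by simp
qed

lemma kendall_ref_eq:
  "kendall_ref r = of_bool (above r 2 1) + of_bool (above r 3 1) + of_bool (above r 4 1)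
     + of_bool (above r 3 2) + of_bool (above r 4 2) + of_bool (above r 4 3)"
proof -
  let ?I = "{1,2,3,4} :: nat set"
  have "{(i,j). i \<in> ?I \<and> j \<in> ?I \<and> i < j \<and> above r j i} = Sigma ?I (\<lambda>i. {j \<in> ?I. i < j \<and> above r j i})"
    by blast
  hence "kendall_ref r = (\<Sum>i\<in>?I. card {j \<in> ?I. i < j \<and> above r j i})"
    unfolding kendall_ref_def by (simp only: card_SigmaI finite_insert finite.emptyI finite_Collect_conjI ball_simps simp_thms Collect_mem_eq)
  also have "\<dots> = (\<Sum>i\<in>?I. \<Sum>j\<in>?I. of_bool (i < j \<and> above r j i))"
    by (intro sum.cong refl) (simp only: card_eq_sum sum.inter_filter finite_insert finite.emptyI of_bool_def)
  finally show ?thesis by simp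
qed

lemma permutations_of_set_three:
  assumes "a \<noteq> b" "a \<noteq> c" "b \<noteq> c"
  shows "permutations_of_set {a,b,c} = {[a,b,c],[a,c,b],[b,a,c],[b,c,a],[c,a,b],[c,b,a]}"
proof -
  have "{a,b,c} - {a} = {b,c}" "{a,b,c} - {b} = {a,c}" "{a,b,c} - {c} = {a,b}" using assms by auto
  thus ?thesis using assms
    by (simp only: permutations_of_set_nonempty[OF insert_not_empty, of a "{b,c}"] Union_insert Union_empty
      permutations_of_set_doubleton not_False_eq_True
      image_insert image_empty Un_insert_left Un_empty_left Un_empty_right)
qed

lemma rankings_eq: "rankings = {[1,2,3,4], [1,2,4,3], [1,3,2,4], [1,3,4,2], [1,4,2,3], [1,4,3,2],
  [2,1,3,4], [2,1,4,3], [2,3,1,4], [2,3,4,1], [2,4,1,3], [2,4,3,1],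
  [3,1,2,4], [3,1,4,2], [3,2,1,4], [3,2,4,1], [3,4,1,2], [3,4,2,1],
  [4,1,2,3], [4,1,3,2], [4,2,1,3], [4,2,3,1], [4,3,1,2], [4,3,2,1]}"
proof -
  have "{1,2,3,4} - {1} = {2,3,4::nat}" "{1,2,3,4} - {2} = {1,3,4::nat}"
    "{1,2,3,4} - {3} = {1,2,4::nat}" "{1,2,3,4} - {4} = {1,2,3::nat}" by auto
  moreover have "permutations_of_set {2,3,4::nat} = {[2,3,4],[2,4,3],[3,2,4],[3,4,2],[4,2,3],[4,3,2]}"
    "permutations_of_set {1,3,4::nat} = {[1,3,4],[1,4,3],[3,1,4],[3,4,1],[4,1,3],[4,3,1]}"
    "permutations_of_set {1,2,4::nat} = {[1,2,4],[1,4,2],[2,1,4],[2,4,1],[4,1,2],[4,2,1]}"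
    "permutations_of_set {1,2,3::nat} = {[1,2,3],[1,3,2],[2,1,3],[2,3,1],[3,1,2],[3,2,1]}"
    by (simp_all only: permutations_of_set_three numeral_eq_iff one_eq_numeral_iff semiring_norm not_False_eq_True)
  ultimately show ?thesis unfolding rankings_def
    by (simp only: permutations_of_set_nonempty[OF insert_not_empty, of 1 "{2,3,4}"]
        Union_insert Union_empty image_insert image_empty Un_insert_left Un_empty_left Un_empty_right)
qed

section \<open>Distribution of the set of candidates preferred to 4\<close>

definition preferred_to_4 :: "nat list \<Rightarrow> nat set" where
  "preferred_to_4 r = {j \<in> {1,2,3}. above r j 4}"

lemma preferred_to_4_eq:
  "preferred_to_4 r = (if above r 1 4 then {1} else {}) \<union> (if above r 2 4 then {2} else {}) \<union> (if above r 3 4 then {3} else {})"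
  by (auto simp: preferred_to_4_def)

text \<open>The summands follow the listing in \<open>rankings_eq\<close>. Keeping F arbitrary lets
  one evaluation serve the normalizing sum and all eight set probabilities.\<close>

lemma sum_rankings:
  fixes F :: "nat \<Rightarrow> nat set \<Rightarrow> real"
  shows "(\<Sum>r\<in>rankings. F (kendall_ref r) (preferred_to_4 r)) =
   F 0 {1,2,3} + F 1 {1,2} + F 1 {1,2,3} + F 2 {1,3} + F 2 {1} + F 3 {1}
  + F 1 {1,2,3} + F 2 {1,2} + F 2 {1,2,3} + F 3 {2,3} + F 3 {2} + F 4 {2}
  + F 2 {1,2,3} + F 3 {1,3} + F 3 {1,2,3} + F 4 {2,3} + F 4 {3} + F 5 {3}
  + F 3 {} + F 4 {} + F 4 {} + F 5 {} + F 5 {} + F 6 {}"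
proof -
  let ?L = "[[1,2,3,4], [1,2,4,3], [1,3,2,4], [1,3,4,2], [1,4,2,3], [1,4,3,2],
  [2,1,3,4], [2,1,4,3], [2,3,1,4], [2,3,4,1], [2,4,1,3], [2,4,3,1],
  [3,1,2,4], [3,1,4,2], [3,2,1,4], [3,2,4,1], [3,4,1,2], [3,4,2,1],
  [4,1,2,3], [4,1,3,2], [4,2,1,3], [4,2,3,1], [4,3,1,2], [4,3,2,1]] :: nat list list"
  have set: "rankings = set ?L" unfolding rankings_eq by (simp only: list.set)
  \<comment> \<open>The list has 4! entries and so does its set, hence it is distinct; no pairwise
    comparison of rankings is made.\<close>
  have "card rankings = fact (card {1,2,3,4::nat})"
    unfolding rankings_def by (rule card_permutations_of_set) simp
  hence "card (set ?L) = length ?L" unfolding set[symmetric] by (simp add: eval_nat_numeral)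
  hence "distinct ?L" by (rule card_distinct)
  hence "(\<Sum>r\<in>rankings. F (kendall_ref r) (preferred_to_4 r)) = (\<Sum>r\<leftarrow>?L. F (kendall_ref r) (preferred_to_4 r))"
    unfolding set by (rule sum.distinct_set_conv_list)
  also have "\<dots> = F 0 {1,2,3} + F 1 {1,2} + F 1 {1,2,3} + F 2 {1,3} + F 2 {1} + F 3 {1}
  + F 1 {1,2,3} + F 2 {1,2} + F 2 {1,2,3} + F 3 {2,3} + F 3 {2} + F 4 {2}
  + F 2 {1,2,3} + F 3 {1,3} + F 3 {1,2,3} + F 4 {2,3} + F 4 {3} + F 5 {3}
  + F 3 {} + F 4 {} + F 4 {} + F 5 {} + F 5 {} + F 6 {}"
    by (simp only: list.map sum_list.Cons sum_list.Nil kendall_ref_eq preferred_to_4_eq above_four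
       numeral_eq_iff one_eq_numeral_iff numeral_eq_one_iff semiring_norm of_bool_eq if_True if_False simp_thms Un_insert_left Un_empty_left Un_empty_right
       add_0 add_0_right add.assoc one_add_one numeral_plus_one one_plus_numeral numeral_plus_numeral)
  finally show ?thesis .
qed

lemma sum_Pow_insert:
  fixes f :: "'b set \<Rightarrow> 'a :: comm_monoid_add"
  assumes "finite A" "x \<notin> A"
  shows "(\<Sum>X\<in>Pow (insert x A). f X) = (\<Sum>X\<in>Pow A. f X) + (\<Sum>X\<in>Pow A. f (insert x X))"
proof -
  have "inj_on (insert x) (Pow A)" using assms(2) by (auto simp: inj_on_def)
  thus ?thesis
    unfolding Pow_insert using assms by (subst sum.union_disjoint) (auto simp: sum.reindex)
qed

lemma sum_Pow_three:
  fixes f :: "nat set \<Rightarrow> 'a :: comm_monoid_add"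
  shows "(\<Sum>X\<in>Pow {1,2,3}. f X) = f {} + f {3} + (f {2} + f {2,3}) + (f {1} + f {1,3} + (f {1,2} + f {1,2,3}))"
  by (subst sum_Pow_insert, simp, simp)+ simp

text \<open>The q-factorial of 4, the generating polynomial of inversions on four letters.\<close>

definition mallows_norm :: "real \<Rightarrow> real" where
  "mallows_norm q = (1 + q) * (1 + q + q^2) * (1 + q + q^2 + q^3)"

lemma mallows_norm_pos: "0 < q \<Longrightarrow> 0 < mallows_norm q"
  by (auto simp: mallows_norm_def intro!: mult_pos_pos add_pos_pos)

lemma sum_kendall: "(\<Sum>r\<in>rankings. exp (- \<rho> * real (kendall_ref r))) = mallows_norm (exp (- \<rho>))"
  unfolding exp_of_nat2_mult sum_rankings[where F = "\<lambda>k _. exp (- \<rho>) ^ k"] mallows_norm_def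
  by (simp add: algebra_simps eval_nat_numeral)

lemma mallows_eq: "r \<in> rankings \<Longrightarrow> mallows \<rho> r = exp (-\<rho>) ^ kendall_ref r / mallows_norm (exp (-\<rho>))"
  unfolding mallows_def sum_kendall by (simp only: if_True exp_of_nat2_mult)

lemma finite_rankings: "finite rankings"
  by (simp add: rankings_def)

lemma pX_sum:
  assumes "X \<subseteq> {1,2,3}"
  shows "pX \<rho> X = (\<Sum>r\<in>rankings. if (1 \<in> preferred_to_4 r \<longleftrightarrow> 1 \<in> X)
      \<and> (2 \<in> preferred_to_4 r \<longleftrightarrow> 2 \<in> X) \<and> (3 \<in> preferred_to_4 r \<longleftrightarrow> 3 \<in> X)
    then exp (-\<rho>) ^ kendall_ref r else 0) / mallows_norm (exp (-\<rho>))"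
proof -
  have "preferred_to_4 r = X \<longleftrightarrow> (1 \<in> preferred_to_4 r \<longleftrightarrow> 1 \<in> X)
      \<and> (2 \<in> preferred_to_4 r \<longleftrightarrow> 2 \<in> X) \<and> (3 \<in> preferred_to_4 r \<longleftrightarrow> 3 \<in> X)" for r
    using assms unfolding preferred_to_4_def by blast
  thus ?thesis
    unfolding pX_def preferred_to_4_def[symmetric] sum_divide_distrib
    by (subst sum.inter_filter[OF finite_rankings]) (intro sum.cong refl, simp only: mallows_eq if_distrib, simp)
qed

lemma pX_values:
  fixes \<rho> :: real
  defines "q \<equiv> exp (-\<rho>)"
  shows "pX \<rho> {} = q^3 * (1 + q) * (1 + q + q^2) / mallows_norm q"
    "pX \<rho> {1} = q^2 * (1 + q) / mallows_norm q"
    "pX \<rho> {2} = q^3 * (1 + q) / mallows_norm q"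
    "pX \<rho> {3} = q^4 * (1 + q) / mallows_norm q"
    "pX \<rho> {1,2} = q * (1 + q) / mallows_norm q"
    "pX \<rho> {1,3} = q^2 * (1 + q) / mallows_norm q"
    "pX \<rho> {2,3} = q^3 * (1 + q) / mallows_norm q"
    "pX \<rho> {1,2,3} = (1 + q) * (1 + q + q^2) / mallows_norm q"
proof -
  define F :: "nat set \<Rightarrow> nat \<Rightarrow> nat set \<Rightarrow> real"
    where "F X k S = (if (1 \<in> S \<longleftrightarrow> 1 \<in> X) \<and> (2 \<in> S \<longleftrightarrow> 2 \<in> X) \<and> (3 \<in> S \<longleftrightarrow> 3 \<in> X)
      then q ^ k else 0)" for X k S
  have pX: "pX \<rho> X = (\<Sum>r\<in>rankings. F X (kendall_ref r) (preferred_to_4 r)) / mallows_norm q"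
    if "X \<subseteq> {1,2,3}" for X
    unfolding F_def q_def by (rule pX_sum[OF that])
  show "pX \<rho> {} = q^3 * (1 + q) * (1 + q + q^2) / mallows_norm q"
    "pX \<rho> {1} = q^2 * (1 + q) / mallows_norm q"
    "pX \<rho> {2} = q^3 * (1 + q) / mallows_norm q"
    "pX \<rho> {3} = q^4 * (1 + q) / mallows_norm q"
    "pX \<rho> {1,2} = q * (1 + q) / mallows_norm q"
    "pX \<rho> {1,3} = q^2 * (1 + q) / mallows_norm q"
    "pX \<rho> {2,3} = q^3 * (1 + q) / mallows_norm q"
    "pX \<rho> {1,2,3} = (1 + q) * (1 + q + q^2) / mallows_norm q"
    by (simp_all only: pX insert_subset empty_subsetI insert_iff simp_thms sum_rankings)
      (simp_all add: F_def, simp_all add: algebra_simps eval_nat_numeral)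
qed

section \<open>The Hessian\<close>

lemma det_two:
  fixes A :: "'a :: comm_ring_1 mat"
  assumes A: "A \<in> carrier_mat 2 2"
  shows "det A = A $$ (0,0) * A $$ (1,1) - A $$ (0,1) * A $$ (1,0)"
proof -
  have c: "mat_delete A 0 j \<in> carrier_mat 1 1" for j
    using mat_delete_carrier[OF A, of 0 j] by simp
  have "det A = (\<Sum>j<2. A $$ (0,j) * cofactor A 0 j)"
    by (rule laplace_expansion_row[OF A]) simp
  also have "\<dots> = A $$ (0,0) * det (mat_delete A 0 0) - A $$ (0,1) * det (mat_delete A 0 1)"
    by (simp add: numeral_2_eq_2 cofactor_def)
  finally have e: "det A = A $$ (0,0) * det (mat_delete A 0 0) - A $$ (0,1) * det (mat_delete A 0 1)" .
  have "det (mat_delete A 0 0) = A $$ (1,1)" "det (mat_delete A 0 1) = A $$ (1,0)"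
    using A by (simp_all add: det_single[OF c]) (simp_all add: mat_delete_def)
  thus ?thesis by (simp only: e)
qed

lemma det_three:
  fixes A :: "'a :: comm_ring_1 mat"
  assumes A: "A \<in> carrier_mat 3 3"
  shows "det A = A $$ (0,0) * (A $$ (1,1) * A $$ (2,2) - A $$ (1,2) * A $$ (2,1))
    - A $$ (0,1) * (A $$ (1,0) * A $$ (2,2) - A $$ (1,2) * A $$ (2,0))
    + A $$ (0,2) * (A $$ (1,0) * A $$ (2,1) - A $$ (1,1) * A $$ (2,0))"
proof -
  have c: "mat_delete A 0 j \<in> carrier_mat 2 2" for j
    using mat_delete_carrier[OF A, of 0 j] by simp
  have "det A = (\<Sum>j<3. A $$ (0,j) * cofactor A 0 j)"
    by (rule laplace_expansion_row[OF A]) simp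
  also have "\<dots> = A $$ (0,0) * det (mat_delete A 0 0) - A $$ (0,1) * det (mat_delete A 0 1)
     + A $$ (0,2) * det (mat_delete A 0 2)"
    by (simp add: eval_nat_numeral cofactor_def)
  finally have e: "det A = A $$ (0,0) * det (mat_delete A 0 0) - A $$ (0,1) * det (mat_delete A 0 1)
     + A $$ (0,2) * det (mat_delete A 0 2)" .
  have "det (mat_delete A 0 0) = A $$ (1,1) * A $$ (2,2) - A $$ (1,2) * A $$ (2,1)"
    "det (mat_delete A 0 1) = A $$ (1,0) * A $$ (2,2) - A $$ (1,2) * A $$ (2,0)"
    "det (mat_delete A 0 2) = A $$ (1,0) * A $$ (2,1) - A $$ (1,1) * A $$ (2,0)"
    unfolding det_two[OF c] using A by (simp_all add: mat_delete_def numeral_2_eq_2)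
  thus ?thesis by (simp only: e)
qed

text \<open>Multiply A * adj A = det A by the inverse from the left. The nonzero determinant ensures
  that \<open>mat_inverse\<close> returns a matrix, so \<open>the\<close> has its intended
  value.\<close>

lemma det_mult_inverse_entry:
  fixes A :: "real mat"
  assumes A: "A \<in> carrier_mat n n" and d: "det A \<noteq> 0" and i: "i < n" "j < n"
  shows "det A * the (mat_inverse A) $$ (i,j) = cofactor A j i"
proof -
  have "A \<in> Units (ring_mat TYPE(real) n ())" by (rule det_non_zero_imp_unit[OF A d])
  with mat_inverse(1)[OF A, of "()"] obtain B where B: "mat_inverse A = Some B"
    by (cases "mat_inverse A") auto
  note Bi = mat_inverse(2)[OF A B]
  have "det A \<cdot>\<^sub>m B = B * (det A \<cdot>\<^sub>m 1\<^sub>m n)"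
    using Bi by (simp add: mult_smult_distrib[of B n n "1\<^sub>m n" n] right_mult_one_mat[of B n n])
  also have "\<dots> = B * (A * adj_mat A)" by (simp only: adj_mat(2)[OF A])
  also have "\<dots> = (B * A) * adj_mat A" using Bi A adj_mat(1)[OF A] assoc_mult_mat[of B n n A n "adj_mat A" n] by simp
  also have "\<dots> = adj_mat A" using Bi adj_mat(1)[OF A] by simp
  finally have "(det A \<cdot>\<^sub>m B) $$ (i,j) = cofactor A j i" using i A by (simp add: adj_mat_def)
  moreover have "dim_row B = n" "dim_col B = n" using Bi by auto
  ultimately show ?thesis using i by (simp add: B)
qed

text \<open>By Cramer's rule the product is the upper left 2 by 2 minor, so candidate 3 drops out.
  The bounds on c keep det H = (1 - c)^2 (1 + 2c) / 64 nonzero.\<close>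

lemma det_mult_M33:
  fixes c :: real
  assumes H: "H = mat 3 3 (\<lambda>(i,j). if i = j then 1/4 else c/4)" and c: "0 < c" "c < 1"
  shows "det H * (the (mat_inverse H)) $$ (2,2) = (1 - c^2) / 16"
proof -
  have C: "H \<in> carrier_mat 3 3" by (simp add: H)
  have "det H = (1 - c)^2 * (1 + 2*c) / 64"
    unfolding det_three[OF C] by (simp add: H power2_eq_square algebra_simps)
  moreover have "0 < (1 - c)^2 * (1 + 2*c) / 64" using c by simp
  ultimately have d: "det H \<noteq> 0" by linarith
  have "mat_delete H 2 2 \<in> carrier_mat 2 2"
    using mat_delete_carrier[OF C, of 2 2] by simp
  from det_two[OF this] have "cofactor H 2 2 = (1 - c^2) / 16"
    by (simp add: cofactor_def mat_delete_def H power2_eq_square diff_divide_distrib)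
  thus ?thesis using det_mult_inverse_entry[OF C d, of 2 2] by simp
qed

text \<open>This family is closed under differentiation: the derivative in t_i keeps exactly the
  terms whose set contains i. Divided by the value for the empty F, it is the tilted probability
  that all of F is preferred to 4.\<close>

definition sum_containing :: "real \<Rightarrow> nat set \<Rightarrow> (nat \<Rightarrow> real) \<Rightarrow> real" where
  "sum_containing \<rho> F t = (\<Sum>X\<in>Pow {1,2,3}. if F \<subseteq> X then pX \<rho> X * (\<Prod>j\<in>X. exp (t j)) else 0)"

lemma Pgen_exp: "Pgen \<rho> (\<lambda>j. exp (t j)) = sum_containing \<rho> {} t"
  by (simp add: Pgen_def sum_containing_def)

lemma Kcgf_eq: "Kcgf \<rho> t = ln (sum_containing \<rho> {} t)"
  by (simp only: Kcgf_def Pgen_exp)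

lemma pX_pos:
  assumes "X \<in> Pow {1,2,3}"
  shows "0 < pX \<rho> X"
proof -
  have "Pow {1,2,3::nat} = {{}, {3}, {2}, {2,3}, {1}, {1,3}, {1,2}, {1,2,3}}"
    by (simp only: Pow_insert Pow_empty image_insert image_empty Un_insert_left Un_empty_left)
  with assms have "X \<in> {{}, {3}, {2}, {2,3}, {1}, {1,3}, {1,2}, {1,2,3}}" by (simp only:)
  thus ?thesis unfolding insert_iff empty_iff
    by (elim disjE) (simp_all only: pX_values, simp_all add: mallows_norm_pos add_pos_pos)
qed

lemma sum_containing_empty_pos: "0 < sum_containing \<rho> {} t"
  unfolding sum_containing_def
  by (intro sum_pos) (auto intro!: mult_pos_pos pX_pos prod_pos)

lemma sum_containing_deriv:
  "((\<lambda>s. sum_containing \<rho> F (t(i := s))) has_real_derivative sum_containing \<rho> (insert i F) (t(i := s))) (at s)"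
proof -
  have fin: "finite X" if "X \<in> Pow {1,2,3::nat}" for X using that by (auto intro: finite_subset)
  have "((\<lambda>s. if F \<subseteq> X then pX \<rho> X * (\<Prod>j\<in>X. exp ((t(i := s)) j)) else 0) has_real_derivative
      (if insert i F \<subseteq> X then pX \<rho> X * (\<Prod>j\<in>X. exp ((t(i := s)) j)) else 0)) (at s)"
    if X: "X \<in> Pow {1,2,3}" for X
  proof (cases "i \<in> X")
    case True
    have e: "(\<Prod>j\<in>X. exp ((t(i := u)) j)) = exp u * (\<Prod>j\<in>X - {i}. exp (t j))" for u
      using prod.remove[OF fin[OF X] True, of "\<lambda>j. exp ((t(i := u)) j)"] by simp
    show ?thesis unfolding e using True by (auto intro!: derivative_eq_intros)
  next
    case False
    have e: "(\<Prod>j\<in>X. exp ((t(i := u)) j)) = (\<Prod>j\<in>X. exp (t j))" for u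
      using False by (intro prod.cong) auto
    show ?thesis unfolding e using False by simp
  qed
  thus ?thesis unfolding sum_containing_def by (intro DERIV_sum)
qed

lemma partial_eqI:
  assumes "((\<lambda>s. f (t(i := s))) has_real_derivative D) (at (t i))"
  shows "partial i f t = D"
  unfolding partial_def using assms by (rule some_equality) (rule DERIV_unique[OF _ assms])

lemma partial_Kcgf: "partial i (Kcgf \<rho>) = (\<lambda>t. sum_containing \<rho> {i} t / sum_containing \<rho> {} t)"
proof
  fix t
  show "partial i (Kcgf \<rho>) t = sum_containing \<rho> {i} t / sum_containing \<rho> {} t"
  proof (rule partial_eqI)
    show "((\<lambda>s. Kcgf \<rho> (t(i := s))) has_real_derivative sum_containing \<rho> {i} t / sum_containing \<rho> {} t) (at (t i))"
      unfolding Kcgf_eq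
      using DERIV_chain2[OF DERIV_ln[OF sum_containing_empty_pos] sum_containing_deriv[of \<rho> "{}" t i "t i"]]
      by (simp add: divide_inverse mult.commute)
  qed
qed

lemma partial_partial_Kcgf:
  "partial i (partial j (Kcgf \<rho>)) t = (sum_containing \<rho> {i,j} t * sum_containing \<rho> {} t
     - sum_containing \<rho> {j} t * sum_containing \<rho> {i} t) / (sum_containing \<rho> {} t)^2"
proof (rule partial_eqI)
  show "((\<lambda>s. partial j (Kcgf \<rho>) (t(i := s))) has_real_derivative (sum_containing \<rho> {i,j} t * sum_containing \<rho> {} t
     - sum_containing \<rho> {j} t * sum_containing \<rho> {i} t) / (sum_containing \<rho> {} t)^2) (at (t i))"
    unfolding partial_Kcgf
    using DERIV_divide[OF sum_containing_deriv[of \<rho> "{j}" t i "t i"] sum_containing_deriv[of \<rho> "{}" t i "t i"]]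
      sum_containing_empty_pos[of \<rho> t]
    by (simp add: power2_eq_square)
qed

text \<open>The correlation, under the tilted law, of the events that two distinct candidates are
  preferred to 4; both events have variance 1/4.\<close>

definition agree_corr :: "real \<Rightarrow> real" where
  "agree_corr q = (1 + q^2) / (1 + 4*q + q^2)"

definition tilt :: "real \<Rightarrow> nat \<Rightarrow> real" where
  "tilt \<rho> j = (if j = 1 then -2*\<rho> else if j = 2 then -\<rho> else 0)"

text \<open>The exponents of the tilt cancel the powers of q that distinguish sets of equal size,
  and its total exponent 3 balances the empty set against the full one. What remains depends only on
  whether the three candidates all lie on the same side of 4.\<close>

lemma tilted_weights:
  fixes \<rho> :: real
  defines "q \<equiv> exp (-\<rho>)"
  defines "C \<equiv> q^3 * (1 + q) / mallows_norm q"
  shows "pX \<rho> {} * (\<Prod>j\<in>{}. exp (tilt \<rho> j)) = (1 + q + q^2) * C"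
    "pX \<rho> {1} * (\<Prod>j\<in>{1}. exp (tilt \<rho> j)) = q * C"
    "pX \<rho> {2} * (\<Prod>j\<in>{2}. exp (tilt \<rho> j)) = q * C"
    "pX \<rho> {3} * (\<Prod>j\<in>{3}. exp (tilt \<rho> j)) = q * C"
    "pX \<rho> {1,2} * (\<Prod>j\<in>{1,2}. exp (tilt \<rho> j)) = q * C"
    "pX \<rho> {1,3} * (\<Prod>j\<in>{1,3}. exp (tilt \<rho> j)) = q * C"
    "pX \<rho> {2,3} * (\<Prod>j\<in>{2,3}. exp (tilt \<rho> j)) = q * C"
    "pX \<rho> {1,2,3} * (\<Prod>j\<in>{1,2,3}. exp (tilt \<rho> j)) = (1 + q + q^2) * C"
proof -
  have e: "exp (tilt \<rho> 1) = q^2" "exp (tilt \<rho> 2) = q" "exp (tilt \<rho> 3) = 1"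
    by (simp_all add: tilt_def q_def power2_eq_square mult_exp_exp)
  have P: "(\<Prod>j\<in>{}. exp (tilt \<rho> j)) = 1" "(\<Prod>j\<in>{1}. exp (tilt \<rho> j)) = q^2"
    "(\<Prod>j\<in>{2}. exp (tilt \<rho> j)) = q" "(\<Prod>j\<in>{3}. exp (tilt \<rho> j)) = 1"
    "(\<Prod>j\<in>{1,2}. exp (tilt \<rho> j)) = q^3" "(\<Prod>j\<in>{1,3}. exp (tilt \<rho> j)) = q^2"
    "(\<Prod>j\<in>{2,3}. exp (tilt \<rho> j)) = q" "(\<Prod>j\<in>{1,2,3}. exp (tilt \<rho> j)) = q^3"
    using e by (simp_all add: eval_nat_numeral)
  show "pX \<rho> {} * (\<Prod>j\<in>{}. exp (tilt \<rho> j)) = (1 + q + q^2) * C"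
    "pX \<rho> {1} * (\<Prod>j\<in>{1}. exp (tilt \<rho> j)) = q * C"
    "pX \<rho> {2} * (\<Prod>j\<in>{2}. exp (tilt \<rho> j)) = q * C"
    "pX \<rho> {3} * (\<Prod>j\<in>{3}. exp (tilt \<rho> j)) = q * C"
    "pX \<rho> {1,2} * (\<Prod>j\<in>{1,2}. exp (tilt \<rho> j)) = q * C"
    "pX \<rho> {1,3} * (\<Prod>j\<in>{1,3}. exp (tilt \<rho> j)) = q * C"
    "pX \<rho> {2,3} * (\<Prod>j\<in>{2,3}. exp (tilt \<rho> j)) = q * C"
    "pX \<rho> {1,2,3} * (\<Prod>j\<in>{1,2,3}. exp (tilt \<rho> j)) = (1 + q + q^2) * C"
    unfolding P pX_values q_def[symmetric] C_def by (simp_all add: eval_nat_numeral)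
qed

lemma sum_containing_tilt:
  fixes \<rho> :: real
  defines "q \<equiv> exp (-\<rho>)"
  defines "C \<equiv> q^3 * (1 + q) / mallows_norm q"
  shows "sum_containing \<rho> {} (tilt \<rho>) = 2 * (1 + 4*q + q^2) * C"
    and "j \<in> {1,2,3} \<Longrightarrow> sum_containing \<rho> {j} (tilt \<rho>) = (1 + 4*q + q^2) * C"
    and "i \<in> {1,2,3} \<Longrightarrow> j \<in> {1,2,3} \<Longrightarrow> i \<noteq> j \<Longrightarrow> sum_containing \<rho> {i,j} (tilt \<rho>) = (1 + 2*q + q^2) * C"
proof -
  have W: "pX \<rho> {} * (\<Prod>j\<in>{}. exp (tilt \<rho> j)) = (1 + q + q^2) * C"
    "pX \<rho> {1} * (\<Prod>j\<in>{1}. exp (tilt \<rho> j)) = q * C"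
    "pX \<rho> {2} * (\<Prod>j\<in>{2}. exp (tilt \<rho> j)) = q * C"
    "pX \<rho> {3} * (\<Prod>j\<in>{3}. exp (tilt \<rho> j)) = q * C"
    "pX \<rho> {1,2} * (\<Prod>j\<in>{1,2}. exp (tilt \<rho> j)) = q * C"
    "pX \<rho> {1,3} * (\<Prod>j\<in>{1,3}. exp (tilt \<rho> j)) = q * C"
    "pX \<rho> {2,3} * (\<Prod>j\<in>{2,3}. exp (tilt \<rho> j)) = q * C"
    "pX \<rho> {1,2,3} * (\<Prod>j\<in>{1,2,3}. exp (tilt \<rho> j)) = (1 + q + q^2) * C"
    unfolding q_def C_def by (rule tilted_weights)+
  show "sum_containing \<rho> {} (tilt \<rho>) = 2 * (1 + 4*q + q^2) * C"
    unfolding sum_containing_def sum_Pow_three W by (simp add: algebra_simps)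
  show "sum_containing \<rho> {j} (tilt \<rho>) = (1 + 4*q + q^2) * C" if "j \<in> {1,2,3}"
    using that unfolding insert_iff empty_iff sum_containing_def sum_Pow_three W
    by (elim disjE) (simp_all add: algebra_simps)
  show "sum_containing \<rho> {i,j} (tilt \<rho>) = (1 + 2*q + q^2) * C" if "i \<in> {1,2,3}" "j \<in> {1,2,3}" "i \<noteq> j"
    using that unfolding insert_iff empty_iff sum_containing_def sum_Pow_three W
    by (elim disjE) (simp_all add: algebra_simps)
qed

lemma hessian_tilt:
  fixes \<rho> :: real
  shows "hessian3 (Kcgf \<rho>) (tilt \<rho>)
    = mat 3 3 (\<lambda>(i,j). if i = j then 1/4 else agree_corr (exp (-\<rho>)) / 4)"
proof -
  define q where "q = exp (-\<rho>)"
  define C where "C = q^3 * (1 + q) / mallows_norm q"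
  define N where "N = 1 + 4*q + q^2"
  have q: "q > 0" by (simp add: q_def)
  have C: "C > 0" using q by (simp add: C_def mallows_norm_pos)
  have N: "N > 0" using q by (simp add: N_def add_pos_pos)
  note s = sum_containing_tilt[where \<rho> = \<rho>, folded q_def, folded C_def, folded N_def]
  have "partial (Suc i) (partial (Suc j) (Kcgf \<rho>)) (tilt \<rho>) = (if i = j then 1/4 else agree_corr q / 4)"
    if "i < 3" "j < 3" for i j
  proof -
    have ij: "Suc i \<in> {1,2,3}" "Suc j \<in> {1,2,3}" using that by auto
    show ?thesis
    proof (cases "i = j")
      case True
      thus ?thesis unfolding partial_partial_Kcgf using C N
        by (simp add: s(1) s(2)[OF ij(2)] power2_eq_square)
    next
      case False
      have "(1 + 2*q + q^2) * C * (2 * N * C) - N * C * (N * C) = N * (C * C) * (1 + q^2)"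
        by (simp add: N_def algebra_simps power2_eq_square)
      hence "((1 + 2*q + q^2) * C * (2 * N * C) - N * C * (N * C)) / (2 * N * C)^2 = (1 + q^2) / N / 4"
        using C N by (simp add: power2_eq_square)
      thus ?thesis unfolding partial_partial_Kcgf using False
        by (simp add: s(1) s(2)[OF ij(1)] s(2)[OF ij(2)] s(3)[OF ij] agree_corr_def N_def)
    qed
  qed
  thus ?thesis unfolding hessian3_def q_def[symmetric] by (intro cong_mat) auto
qed

section \<open>The winning probability\<close>

lemma mono2_add: "mono2 c a b + mono2 c' a b = mono2 (c + c') a b"
  by (simp add: mono2_def add_monom)

lemma mono2_sum: "finite A \<Longrightarrow> (\<Sum>x\<in>A. mono2 (f x) a b) = mono2 (\<Sum>x\<in>A. f x) a b"
  by (induction A rule: finite_induct) (simp_all add: mono2_add, simp add: mono2_def)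

lemma prod_mono2: "finite A \<Longrightarrow> (\<Prod>x\<in>A. mono2 (c x) (a x) (b x))
    = mono2 (\<Prod>x\<in>A. c x) (\<Sum>x\<in>A. a x) (\<Sum>x\<in>A. b x)"
  by (induction A rule: finite_induct) (simp_all add: mono2_mult, simp add: mono2_def)

lemma prod_monom: "finite A \<Longrightarrow> (\<Prod>x\<in>A. monom (c x :: real) (h x)) = monom (\<Prod>x\<in>A. c x) (\<Sum>x\<in>A. h x)"
  by (induction A rule: finite_induct) (simp_all add: mult_monom)

lemma weighted_lower_mass_sum: "weighted_lower_mass q m (\<Sum>x\<in>A. f x) = (\<Sum>x\<in>A. weighted_lower_mass q m (f x))"
  unfolding weighted_lower_mass_def coeff_sum lower_mass_sum sum_distrib_left
  by (subst sum.swap) (intro sum.cong refl sum.swap | subst sum.swap)+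

lemma lower_mass_monom: "lower_mass m (monom c h) = (if h \<le> m then c else 0)"
  by (simp add: lower_mass_def coeff_monom)

lemma weighted_lower_mass_mono2:
  "weighted_lower_mass q m (mono2 (monom c h) a b)
    = (if a \<le> m \<and> b \<le> m \<and> h \<le> m then q^(2*(m-a) + (m-b)) * c else 0)"
proof -
  have "weighted_lower_mass q m (mono2 (monom c h) a b)
    = (\<Sum>i\<le>m. \<Sum>j\<le>m. if a = i then if b = j then q^(2*(m-i) + (m-j)) * lower_mass m (monom c h) else 0 else 0)"
    unfolding weighted_lower_mass_def coeff_mono2 by (intro sum.cong refl) auto
  also have "\<dots> = (\<Sum>i\<le>m. if a = i then \<Sum>j\<le>m. if b = j then q^(2*(m-i) + (m-j)) * lower_mass m (monom c h) else 0 else 0)"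
    by (intro sum.cong refl) auto
  also have "\<dots> = (if a \<le> m \<and> b \<le> m \<and> h \<le> m then q^(2*(m-a) + (m-b)) * c else 0)"
    by (simp add: sum.delta' lower_mass_monom)
  finally show ?thesis .
qed

lemma weighted_lower_mass_scale: "weighted_lower_mass q m (mono2 [:c:] 0 0 * P) = c * weighted_lower_mass q m P"
proof -
  have "mono2 [:c:] 0 0 * P = Polynomial.smult [:[:c:]:] P" by (simp add: mono2_def monom_0)
  thus ?thesis by (simp add: weighted_lower_mass_def lower_mass_smult sum_distrib_left mult_ac)
qed

text \<open>The tilt is attached ballot by ballot, so a product over voters collects it
  automatically. Candidate 3 has no power of q because its tilting factor is 1.\<close>

definition ballot_poly :: "real \<Rightarrow> nat set \<Rightarrow> real \<Rightarrow> real poly poly poly" where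
  "ballot_poly q X w = mono2 (monom (w * ((q^2) ^ of_bool (1 \<in> X) * q ^ of_bool (2 \<in> X))) (of_bool (3 \<in> X)))
     (of_bool (1 \<in> X)) (of_bool (2 \<in> X))"

lemma ballot_poly_sum: "finite A \<Longrightarrow> (\<Sum>x\<in>A. ballot_poly q X (f x)) = ballot_poly q X (\<Sum>x\<in>A. f x)"
proof -
  have "(\<Sum>x\<in>A. monom (f x * c) h) = monom ((\<Sum>x\<in>A. f x) * c) h" for c h
    by (rule poly_eqI) (simp add: coeff_sum coeff_monom sum_distrib_right)
  thus "finite A \<Longrightarrow> ?thesis" by (simp only: ballot_poly_def mono2_sum)
qed

text \<open>Four of the tilted weights, each q * C out of the total 2 (1 + 4q + q^2) C, belong to
  sets containing exactly one of 1 and 2.\<close>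

definition disagree_prob :: "real \<Rightarrow> real" where
  "disagree_prob q = 2*q / (1 + 4*q + q^2)"

definition side_prob :: "real \<Rightarrow> real" where
  "side_prob q = (1 + q + q^2) / (1 + 2*q + q^2)"

lemma sum_ballot_poly:
  fixes \<rho> :: real
  defines "q \<equiv> exp (-\<rho>)"
  shows "(\<Sum>r\<in>rankings. ballot_poly q (preferred_to_4 r) (mallows \<rho> r))
    = mono2 [:sum_containing \<rho> {} (tilt \<rho>):] 0 0 * voter_poly (disagree_prob q) (side_prob q)"
proof -
  define C where "C = q^3 * (1 + q) / mallows_norm q"
  define N where "N = 1 + 4*q + q^2"
  define M where "M = 1 + 2*q + q^2"
  have q: "q > 0" by (simp add: q_def)
  have N: "N \<noteq> 0" using q by (simp add: N_def add_pos_pos less_imp_neq[symmetric])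
  have M: "M \<noteq> 0" using q by (simp add: M_def add_pos_pos less_imp_neq[symmetric])
  have p: "disagree_prob q = 2 * q / N" "1 - disagree_prob q = M / N"
    using N by (simp_all add: disagree_prob_def N_def[symmetric] divide_simps) (simp add: N_def M_def)
  have r: "side_prob q = (1 + q + q^2) / M" "1 - side_prob q = q / M"
    using M by (simp_all add: side_prob_def M_def[symmetric] divide_simps) (simp add: M_def)
  have r3: "1 - q / M = (1 + q + q^2) / M"
    using M by (simp add: divide_simps) (simp add: M_def)
  have P0: "sum_containing \<rho> {} (tilt \<rho>) = 2 * N * C"
    using sum_containing_tilt(1)[of \<rho>] by (simp add: N_def C_def q_def)
  have e: "exp (tilt \<rho> 1) = q^2" "exp (tilt \<rho> 2) = q" "exp (tilt \<rho> 3) = 1"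
    by (simp_all add: tilt_def q_def power2_eq_square mult_exp_exp)
  have b: "ballot_poly q X (pX \<rho> X) = mono2 (monom (pX \<rho> X * (\<Prod>j\<in>X. exp (tilt \<rho> j))) (of_bool (3 \<in> X)))
     (of_bool (1 \<in> X)) (of_bool (2 \<in> X))" if "X \<in> Pow {1,2,3}" for X
  proof -
    have "(\<Prod>j\<in>X. exp (tilt \<rho> j)) = (\<Prod>j\<in>{1,2,3}. exp (tilt \<rho> j) ^ of_bool (j \<in> X))"
      using that by (intro prod.mono_neutral_cong_left) auto
    also have "\<dots> = (q^2) ^ of_bool (1 \<in> X) * q ^ of_bool (2 \<in> X)"
      using e by simp
    finally show ?thesis by (simp only: ballot_poly_def)
  qed
  have "(\<Sum>r\<in>rankings. ballot_poly q (preferred_to_4 r) (mallows \<rho> r))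
     = (\<Sum>X\<in>Pow {1,2,3}. \<Sum>r\<in>{r \<in> rankings. preferred_to_4 r = X}. ballot_poly q (preferred_to_4 r) (mallows \<rho> r))"
    by (rule sum.group[symmetric]) (auto simp: finite_rankings preferred_to_4_def)
  also have "\<dots> = (\<Sum>X\<in>Pow {1,2,3}. ballot_poly q X (pX \<rho> X))"
    unfolding pX_def preferred_to_4_def[symmetric]
    by (intro sum.cong refl) (simp add: ballot_poly_sum[symmetric] finite_rankings)
  also have "\<dots> = (\<Sum>X\<in>Pow {1,2,3}. mono2 (monom (pX \<rho> X * (\<Prod>j\<in>X. exp (tilt \<rho> j))) (of_bool (3 \<in> X)))
     (of_bool (1 \<in> X)) (of_bool (2 \<in> X)))"
    by (intro sum.cong refl b)
  \<comment> \<open>Each outer monomial fixes the membership of 1 and 2; its linear coefficient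
    polynomial lists the weights without and with candidate 3.\<close>
  also have "\<dots> = mono2 [:(1 + q + q^2) * C, q * C:] 0 0 + mono2 [:q * C, q * C:] 0 1
      + (mono2 [:q * C, q * C:] 1 0 + mono2 [:q * C, (1 + q + q^2) * C:] 1 1)"
    unfolding sum_Pow_three tilted_weights[of \<rho>, folded q_def, folded C_def]
    by (simp add: mono2_add monom_0 monom_Suc)
  also have "\<dots> = mono2 [:2 * N * C:] 0 0 * voter_poly (disagree_prob q) (side_prob q)"
    unfolding voter_poly_def distrib_left mono2_mult p(2) r(2) unfolding p(1) r(1) using N M by (simp add: r3)
  finally show ?thesis by (simp only: P0)
qed

lemma above_4_iff: "r \<in> rankings \<Longrightarrow> j \<in> {1,2,3} \<Longrightarrow> above r 4 j \<longleftrightarrow> j \<notin> preferred_to_4 r"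
proof -
  have "\<forall>r\<in>rankings. \<forall>j\<in>{1,2,3}. above r 4 j \<longleftrightarrow> \<not> above r j 4"
    unfolding rankings_eq
    by (simp only: ball_simps above_four numeral_eq_iff one_eq_numeral_iff numeral_eq_one_iff semiring_norm simp_thms)
  thus "r \<in> rankings \<Longrightarrow> j \<in> {1,2,3} \<Longrightarrow> ?thesis" by (auto simp: preferred_to_4_def)
qed

text \<open>If N voters prefer j to 4, then n - N > n/2 means 2N < n. At n = 0 truncated subtraction
  breaks this: there is no strict majority, yet 0 \<le> 0 holds.\<close>

lemma condorcet4_iff:
  assumes n: "n > 0" and prof: "\<And>v. v < n \<Longrightarrow> prof v \<in> rankings"
  shows "condorcet4 n prof \<longleftrightarrow> (\<forall>j\<in>{1,2,3}. (\<Sum>v<n. of_bool (j \<in> preferred_to_4 (prof v))) \<le> (n - 1) div 2)"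
proof -
  have "real (card {v \<in> {..<n}. above (prof v) 4 j}) > real n
      / 2 \<longleftrightarrow> (\<Sum>v<n. of_bool (j \<in> preferred_to_4 (prof v))) \<le> (n - 1) div 2"
    if j: "j \<in> {1,2,3}" for j
  proof -
    have "{v \<in> {..<n}. above (prof v) 4 j} = {..<n} - {v \<in> {..<n}. j \<in> preferred_to_4 (prof v)}"
      using above_4_iff[OF prof j] by auto
    also have "card \<dots> = n - card {v \<in> {..<n}. j \<in> preferred_to_4 (prof v)}"
      by (subst card_Diff_subset) auto
    finally have "card {v \<in> {..<n}. above (prof v) 4 j} = n - card {v \<in> {..<n}. j \<in> preferred_to_4 (prof v)}" .
    moreover have "card {v \<in> {..<n}. j \<in> preferred_to_4 (prof v)} \<le> card {..<n}"
      by (intro card_mono) auto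
    moreover have "(\<Sum>v<n. of_bool (j \<in> preferred_to_4 (prof v))) = card {v \<in> {..<n}. j \<in> preferred_to_4 (prof v)}"
      by (simp add: Int_def)
    ultimately show ?thesis using n by auto
  qed
  thus ?thesis unfolding condorcet4_def by (rule ball_cong[OF refl])
qed

lemma prob_cw4_eq:
  fixes \<rho> :: real
  defines "q \<equiv> exp (-\<rho>)"
  assumes n: "n > 0"
  defines "m \<equiv> (n - 1) div 2"
  shows "prob_cw4 \<rho> n * (q^2)^m * q^m = sum_containing \<rho> {} (tilt \<rho>) ^ n
    * weighted_lower_mass q m (voter_poly (disagree_prob q) (side_prob q) ^ n)"
proof -
  let ?N = "\<lambda>prof j. \<Sum>v<n. of_bool (j \<in> preferred_to_4 (prof v)) :: nat"
  let ?G = "\<Sum>r\<in>rankings. ballot_poly q (preferred_to_4 r) (mallows \<rho> r)"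
  have "?G ^ n = (\<Prod>v<n. ?G)" by simp
  also have "\<dots> = (\<Sum>prof\<in>PiE {..<n} (\<lambda>_. rankings). \<Prod>v<n. ballot_poly q (preferred_to_4 (prof v)) (mallows \<rho> (prof v)))"
    by (rule prod_sum_PiE) (auto simp: finite_rankings)
  also have "\<dots> = (\<Sum>prof\<in>PiE {..<n} (\<lambda>_. rankings).
      mono2 (monom ((\<Prod>v<n. mallows \<rho> (prof v)) * ((q^2) ^ ?N prof 1 * q ^ ?N prof 2)) (?N prof 3)) (?N prof 1) (?N prof 2))"
    by (intro sum.cong refl)
       (simp only: ballot_poly_def prod_mono2[OF finite_lessThan] prod_monom[OF finite_lessThan] prod.distrib power_sum)
  finally have "weighted_lower_mass q m (?G ^ n) = (\<Sum>prof\<in>PiE {..<n} (\<lambda>_. rankings).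
      if ?N prof 1 \<le> m \<and> ?N prof 2 \<le> m \<and> ?N prof 3 \<le> m
      then q^(2*(m-?N prof 1) + (m-?N prof 2)) * ((\<Prod>v<n. mallows \<rho> (prof v)) * ((q^2) ^ ?N prof 1 * q ^ ?N prof 2)) else 0)"
    by (simp only: weighted_lower_mass_sum weighted_lower_mass_mono2)
  also have "\<dots> = (\<Sum>prof\<in>PiE {..<n} (\<lambda>_. rankings).
      (if condorcet4 n prof then (\<Prod>v<n. mallows \<rho> (prof v)) else 0) * ((q^2)^m * q^m))"
  proof (intro sum.cong refl)
    fix prof assume "prof \<in> PiE {..<n} (\<lambda>_. rankings)"
    hence "condorcet4 n prof \<longleftrightarrow> (\<forall>j\<in>{1,2,3}. ?N prof j \<le> m)"
      unfolding m_def by (intro condorcet4_iff n) auto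
    hence c: "condorcet4 n prof \<longleftrightarrow> ?N prof 1 \<le> m \<and> ?N prof 2 \<le> m \<and> ?N prof 3 \<le> m" by simp
    \<comment> \<open>On the winning event the tilt and the weight that undoes it multiply to the
      constant q^(3m); a, b \<le> m makes the natural subtractions exact.\<close>
    have w: "q^(2*(m-a) + (m-b)) * (P * ((q^2) ^ a * q ^ b)) = P * ((q^2)^m * q^m)"
      if "a \<le> m" "b \<le> m" for a b P
    proof -
      have "q^(2*(m-a) + (m-b)) * (P * ((q^2) ^ a * q ^ b)) = P * (((q^2)^(m-a) * (q^2)^a) * (q^(m-b) * q^b))"
        by (simp add: power_add power_mult)
      also have "\<dots> = P * ((q^2)^m * q^m)" using that by (simp only: power_add[symmetric] le_add_diff_inverse2)
      finally show ?thesis .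
    qed
    show "(if ?N prof 1 \<le> m \<and> ?N prof 2 \<le> m \<and> ?N prof 3 \<le> m
      then q^(2*(m-?N prof 1) + (m-?N prof 2)) * ((\<Prod>v<n. mallows \<rho> (prof v)) * ((q^2) ^ ?N prof 1 * q ^ ?N prof 2)) else 0)
      = (if condorcet4 n prof then (\<Prod>v<n. mallows \<rho> (prof v)) else 0) * ((q^2)^m * q^m)"
    proof (cases "condorcet4 n prof")
      case True
      note N = True[unfolded c]
      from N have le: "?N prof 1 \<le> m" "?N prof 2 \<le> m" by blast+
      show ?thesis unfolding if_P[OF True] if_P[OF N] by (rule w[OF le])
    next
      case False
      show ?thesis unfolding if_not_P[OF False] if_not_P[OF False[unfolded c]] by simp
    qed
  qed
  also have "\<dots> = prob_cw4 \<rho> n * (q^2)^m * q^m"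
    by (simp only: prob_cw4_def sum_distrib_right[symmetric] mult.assoc)
  finally have "prob_cw4 \<rho> n * (q^2)^m * q^m = weighted_lower_mass q m (?G ^ n)" by simp
  also have "?G ^ n = mono2 [:sum_containing \<rho> {} (tilt \<rho>) ^ n:] 0 0 * voter_poly (disagree_prob q) (side_prob q) ^ n"
    unfolding q_def sum_ballot_poly power_mult_distrib mono2_power by (simp add: poly_const_pow)
  finally show ?thesis by (simp only: weighted_lower_mass_scale)
qed

theorem theorem7:
  fixes \<rho> :: real
  assumes "\<rho> > 0"
  defines "\<zeta> \<equiv> (\<lambda>j::nat. if j = 1 then exp (-2*\<rho>) else if j = 2 then exp (-\<rho>) else 1)"
      and "\<tau> \<equiv> (\<lambda>j::nat. if j = 1 then -2*\<rho> else if j = 2 then -\<rho> else 0)"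
      and "S \<equiv> {1::nat, 2}"
  defines "H \<equiv> hessian3 (Kcgf \<rho>) \<tau>"
  defines "M33 \<equiv> (the (mat_inverse H)) $$ (2,2)"
  shows "(\<lambda>n. prob_cw4 \<rho> n) \<sim>[at_top]
    (\<lambda>n. Pgen \<rho> \<zeta> ^ n
        / (\<Prod>j\<in>S. (1 - \<zeta> j) * \<zeta> j ^ (nat \<lceil>real n / 2\<rceil> - 1))
        * (1 / (4 * pi * real n * sqrt (det H * M33))))"
proof -
  define q where "q = exp (-\<rho>)"
  define p where "p = disagree_prob q"
  define r where "r = side_prob q"
  define c where "c = agree_corr q"
  have q: "0 < q" "q < 1" using assms(1) by (simp_all add: q_def)
  have q2: "q^2 < 1" using q by (simp add: power_less_one_iff)
  have N: "0 < 1 + 4*q + q^2" using q by (simp add: add_pos_pos)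
  have q3: "0 < 1 + q^2" by (simp add: add_pos_nonneg)
  have c: "0 < c" "c < 1" using q q3 N by (simp_all add: c_def agree_corr_def)
  have p: "0 < p" "p < 1" using q N add_pos_pos[OF _ q3, of "2 * q"] by (simp_all add: p_def disagree_prob_def)
  have r: "0 < r" "r < 1" using q by (simp_all add: r_def side_prob_def add_pos_pos)
  \<comment> \<open>For two fair events the correlation is 1 minus twice the chance that exactly one
    occurs. This converts the covariance minor into the p(1-p) of the local limit.\<close>
  have "p = (1 - c) / 2" using N by (simp add: p_def c_def disagree_prob_def agree_corr_def divide_simps)
  hence cp: "c = 1 - 2 * p" by simp
  have pc: "(1 - c^2) / 16 = p * (1 - p) / 4" unfolding cp by (simp add: power2_eq_square field_simps)
  have \<tau>: "\<tau> = tilt \<rho>" by (simp add: \<tau>_def tilt_def fun_eq_iff)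
  have "\<zeta> = (\<lambda>j. exp (tilt \<rho> j))" by (simp add: \<zeta>_def tilt_def fun_eq_iff)
  hence P0: "Pgen \<rho> \<zeta> = sum_containing \<rho> {} (tilt \<rho>)" by (simp only: Pgen_exp)
  have "\<zeta> 1 = q^2" "\<zeta> 2 = q" by (simp_all add: \<zeta>_def q_def power2_eq_square mult_exp_exp)
  hence S: "(\<Prod>j\<in>S. (1 - \<zeta> j) * \<zeta> j ^ k) = (1 - q^2) * (q^2)^k * ((1 - q) * q^k)" for k
    by (simp add: S_def)
  have "det H * M33 = (1 - c^2) / 16"
    unfolding M33_def by (rule det_mult_M33[OF _ c]) (simp only: H_def \<tau> hessian_tilt c_def q_def)
  hence "det H * M33 = p * (1 - p) / 4" by (simp only: pc)
  hence D: "sqrt (det H * M33) = sqrt (p * (1 - p)) / 2" by (simp only: real_sqrt_divide real_sqrt_four)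
  \<comment> \<open>The reciprocal of the limit of \<open>T\<close>. It has 2 pi where the claim has
    4 pi, since sqrt (det H * M33) is half of sqrt (p * (1 - p)).\<close>
  define \<kappa> where "\<kappa> = 2 * pi * sqrt (p * (1 - p)) * ((1 - q^2) * (1 - q))"
  have P0pos: "Pgen \<rho> \<zeta> > 0" unfolding P0 by (rule sum_containing_empty_pos)
  define T where "T n = real n * weighted_lower_mass q ((n - 1) div 2) (voter_poly p r ^ n)" for n
  let ?R = "\<lambda>n. Pgen \<rho> \<zeta> ^ n
        / (\<Prod>j\<in>S. (1 - \<zeta> j) * \<zeta> j ^ (nat \<lceil>real n / 2\<rceil> - 1))
        * (1 / (4 * pi * real n * sqrt (det H * M33)))"
  have eq: "prob_cw4 \<rho> n / ?R n = \<kappa> * T n" if n: "n > 0" for n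
  proof -
    define m where "m = (n - 1) div 2"
    have m: "nat \<lceil>real n / 2\<rceil> - 1 = m"
    proof -
      have "\<lceil>real n / 2\<rceil> = int m + 1"
        using n by (intro ceiling_unique) (auto simp: m_def elim!: evenE oddE)
      thus ?thesis by simp
    qed
    have "prob_cw4 \<rho> n * (q^2)^m * q^m = Pgen \<rho> \<zeta> ^ n * weighted_lower_mass q m (voter_poly p r ^ n)"
      unfolding P0 p_def r_def q_def m_def by (rule prob_cw4_eq[OF n])
    hence e: "prob_cw4 \<rho> n = Pgen \<rho> \<zeta> ^ n * weighted_lower_mass q m (voter_poly p r ^ n) / ((q^2)^m * q^m)"
      using q by (simp add: field_simps)
    have "x * w / (a * b) / (x / (u * a * (v * b)) * (1 / (4 * pi * real n * (s / 2)))) = 2 * pi * s * (u * v) * (real n * w)"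
      if "x > 0" "a > 0" "b > 0" "u > 0" "v > 0" "s > 0" for x w a b u v s :: real
      using that n by (simp add: divide_simps)
    thus ?thesis unfolding S D m e \<kappa>_def T_def m_def[symmetric]
      using P0pos q q2 p by simp
  qed
  have "T \<longlonglongrightarrow> 1 / (2 * pi * sqrt (p * (1 - p))) / ((1 - q^2) * (1 - q))"
    unfolding T_def by (rule weighted_lower_mass_tendsto) (use p q r in auto)
  hence "(\<lambda>n. \<kappa> * T n) \<longlonglongrightarrow> \<kappa> * (1 / (2 * pi * sqrt (p * (1 - p))) / ((1 - q^2) * (1 - q)))"
    by (intro tendsto_intros)
  also have "\<kappa> * (1 / (2 * pi * sqrt (p * (1 - p))) / ((1 - q^2) * (1 - q))) = 1"
    using p q q2 by (auto simp: \<kappa>_def)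
  finally have "(\<lambda>n. \<kappa> * T n) \<longlonglongrightarrow> 1" .
  moreover have "\<forall>\<^sub>F n in at_top. \<kappa> * T n = prob_cw4 \<rho> n / ?R n"
    using eventually_gt_at_top[of 0] by eventually_elim (simp only: eq)
  ultimately have "(\<lambda>n. prob_cw4 \<rho> n / ?R n) \<longlonglongrightarrow> 1" by (rule Lim_transform_eventually)
  thus ?thesis by (rule asymp_equivI')
qed

end
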